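(* Let $P(t)(x)=x^n-a_1(t)x^{n-1}+\dots+(-1)^na_n(t)$, $t\in\mathbb R$, where each $a_i:\mathbb R\to\mathbb R$ is of class $C^n$ and all roots of $P(t)$ are real for every $t$. Then there exist differentiable functions $x_1,\dots,x_n:\mathbb R\to\mathbb R$ such that $P(t)(x)=\prod_{i=1}^n(x-x_i(t))$ for all $t\in\mathbb R$. *)

theory Defs
  imports "HOL-Analysis.Analysis" "HOL-Computational_Algebra.Polynomial"
begin

definition C_k :: "nat \<Rightarrow> (real \<Rightarrow> real) \<Rightarrow> bool" where
  "C_k k f \<longleftrightarrow> (\<forall>j<k. \<forall>x. (deriv ^^ j) f differentiable (at x))
                 \<and> continuous_on UNIV ((deriv ^^ k) f)"

definition hyp_poly :: "nat \<Rightarrow> (nat \<Rightarrow> real) \<Rightarrow> real poly" where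
  "hyp_poly n a = monom 1 n + (\<Sum>i=1..n. monom ((-1) ^ i * a i) (n - i))"

end

theory Submission
  imports Defs "HOL-Library.Multiset" "HOL-Computational_Algebra.Formal_Power_Series" "HOL-Computational_Algebra.Fundamental_Theorem_Algebra"
begin

unbundle no vec_syntax
unbundle fps_syntax

text \<open>
  Fix a time \<open>b\<close>. By Newton's identities the power sums of the roots, and hence all sums of a fixed
  polynomial over the roots, have Taylor expansions of order \<open>n\<close> at \<open>b\<close>. The sum of
  \<open>\<Prod>\<mu> (x - \<mu>)\<^sup>2\<close> over the roots \<open>x\<close> at time \<open>t\<close>, where \<open>\<mu>\<close> runs through the distinct roots at time
  \<open>b\<close>, is nonnegative and vanishes at \<open>b\<close>; so it is \<open>O((t - b)\<^sup>2)\<close>, and every root stays within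
  \<open>O(t - b)\<close> of some \<open>\<mu>\<close>. Summing polynomials that behave like \<open>(x - \<mu>) ^ k\<close> near \<open>\<mu>\<close> and vanish
  to order \<open>k + 1\<close> at the other roots shows that the power sums of the difference quotients
  \<open>(x - \<mu>) / (t - b)\<close> of the roots near \<open>\<mu>\<close> converge, with the same limits from both sides. Hence
  for each single \<open>b\<close> the roots can be enumerated by functions that are differentiable at \<open>b\<close>.

  This pointwise property already implies a global differentiable choice. One selects one root
  function at a time: removing a differentiable selection preserves the pointwise property. The
  selection is built by induction on the number of branches. Where all branches have the same value
  and derivative, every selection is differentiable. Near any other time, the branches tangent to a
  given line occupy a cone of their own on the punctured neighbourhood, so that the induction
  hypothesis yields a selection through every tangent direction; as a selection on an interval has
  one of these directions as its limit at an end point, selections can be prolonged, and Zorn's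
  lemma finishes the argument.
\<close>

section \<open>Newton's identities\<close>

text \<open>Coefficient \<open>k\<close> is the \<open>k\<close>-th elementary symmetric function of
  \<open>A\<close> with sign \<open>(- 1) ^ k\<close>. As a power series the product has
  coefficients of every index, and its logarithmic derivative generates the power sums.\<close>

definition elem_fps :: "real multiset \<Rightarrow> real fps" where
  "elem_fps A = (\<Prod>x\<in>#A. 1 - fps_const x * fps_X)"

definition psum :: "nat \<Rightarrow> real multiset \<Rightarrow> real" where
  "psum k A = (\<Sum>x\<in>#A. x ^ k)"

definition roots_poly :: "real multiset \<Rightarrow> real poly" where
  "roots_poly A = (\<Prod>x\<in>#A. [:- x, 1:])"

lemma elem_fps_empty [simp]: "elem_fps {#} = 1"
  and elem_fps_add [simp]: "elem_fps (add_mset x A) = (1 - fps_const x * fps_X) * elem_fps A"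
  by (simp_all add: elem_fps_def)

lemma psum_empty [simp]: "psum k {#} = 0"
  and psum_add [simp]: "psum k (add_mset x A) = x ^ k + psum k A"
  by (simp_all add: psum_def)

lemma roots_poly_empty [simp]: "roots_poly {#} = 1"
  and roots_poly_add [simp]: "roots_poly (add_mset x A) = [:- x, 1:] * roots_poly A"
  by (simp_all add: roots_poly_def)

lemma elem_fps_nth_add:
  "elem_fps (add_mset x A) $ k = elem_fps A $ k - (if k = 0 then 0 else x * elem_fps A $ (k - 1))"
  by (simp add: left_diff_distrib fps_mult_fps_X_commute mult.assoc)

text \<open>This is the logarithmic derivative of the product: the factor of \<open>x\<close>
  contributes \<open>- x / (1 - x X)\<close>, a geometric series with coefficients
  \<open>- x ^ Suc k\<close>. The multiplied-out form avoids inverting power series.\<close>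

lemma fps_deriv_elem_fps:
  "fps_deriv (elem_fps A) = - (elem_fps A * Abs_fps (\<lambda>k. psum (Suc k) A))"
proof (induction A)
  case empty
  then show ?case by (simp add: fps_eq_iff)
next
  case (add x A)
  define S where "S = Abs_fps (\<lambda>k. psum (Suc k) A)"
  define g where "g = Abs_fps (\<lambda>k. x ^ Suc k)"
  have S': "Abs_fps (\<lambda>k. psum (Suc k) (add_mset x A)) = g + S"
    by (simp add: S_def g_def fps_eq_iff)
  have g: "(1 - fps_const x * fps_X) * g = fps_const x"
    unfolding fps_eq_iff
  proof
    fix k show "((1 - fps_const x * fps_X) * g) $ k = fps_const x $ k"
      by (cases k) (simp_all add: left_diff_distrib mult.assoc g_def)
  qed
  have "fps_deriv (elem_fps (add_mset x A))
      = (1 - fps_const x * fps_X) * fps_deriv (elem_fps A) - fps_const x * elem_fps A"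
    by (simp add: algebra_simps)
  also have "\<dots> = - ((1 - fps_const x * fps_X) * elem_fps A * S) - ((1 - fps_const x * fps_X) * g) * elem_fps A"
    by (simp only: g add.IH S_def) (simp add: algebra_simps)
  also have "\<dots> = - (elem_fps (add_mset x A) * (g + S))"
    by (simp only: elem_fps_add) (simp add: algebra_simps)
  finally show ?case by (simp only: S')
qed

text \<open>Compare the coefficients of index \<open>k\<close> in the preceding equation. The
  summand \<open>j = 0\<close> is \<open>psum (Suc k) A\<close>, so the identity can be solved for
  the coefficient as well as for the power sum; both directions occur below.\<close>

lemma newton_identity:
  "real (Suc k) * elem_fps A $ Suc k = - (\<Sum>j=0..k. elem_fps A $ j * psum (Suc k - j) A)"
proof -
  have "fps_deriv (elem_fps A) $ k = - (\<Sum>j=0..k. elem_fps A $ j * psum (Suc (k - j)) A)"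
    by (simp add: fps_deriv_elem_fps fps_mult_nth)
  moreover have "(\<Sum>j=0..k. elem_fps A $ j * psum (Suc (k - j)) A) = (\<Sum>j=0..k. elem_fps A $ j * psum (Suc k - j) A)"
    by (intro sum.cong) (auto simp: Suc_diff_le)
  ultimately show ?thesis by (simp add: algebra_simps)
qed

lemma elem_fps_nth_0 [simp]: "elem_fps A $ 0 = 1"
  by (induction A) (simp_all add: elem_fps_nth_add del: elem_fps_add)

lemma elem_fps_nth_eq_0: "size A < k \<Longrightarrow> elem_fps A $ k = 0"
  by (induction A arbitrary: k) (simp_all add: elem_fps_nth_add del: elem_fps_add)

section \<open>Coefficients of products of linear factors\<close>

lemma smult_sum_right: "smult c (\<Sum>i\<in>S. f i) = (\<Sum>i\<in>S. smult c (f i))"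
  by (induction S rule: infinite_finite_induct) (simp_all add: smult_add_right)

lemma pCons_0_sum: "pCons 0 (\<Sum>i\<in>S. f i) = (\<Sum>i\<in>S. pCons 0 (f i))"
  by (induction S rule: infinite_finite_induct) (simp_all, metis add_pCons add_0)

text \<open>The recursion \<open>elem_fps_nth_add\<close> splits the sum into the indeterminate
  times the old polynomial minus \<open>x\<close> times the old polynomial.\<close>

lemma roots_poly_eq:
  "roots_poly A = (\<Sum>k\<le>size A. monom (elem_fps A $ k) (size A - k))"
proof (induction A)
  case (add x A)
  let ?m = "size A"
  have "(\<Sum>k\<le>Suc ?m. monom (elem_fps (add_mset x A) $ k) (Suc ?m - k))
     = (\<Sum>k\<le>Suc ?m. monom (elem_fps A $ k) (Suc ?m - k))
       - (\<Sum>k\<le>Suc ?m. if k = 0 then 0 else monom (x * elem_fps A $ (k - 1)) (Suc ?m - k))"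
    unfolding sum_subtractf[symmetric] 
    by (intro sum.cong refl) (simp add: elem_fps_nth_add diff_monom[symmetric] del: elem_fps_add)
  also have "(\<Sum>k\<le>Suc ?m. if k = 0 then 0 else monom (x * elem_fps A $ (k - 1)) (Suc ?m - k))
     = smult x (roots_poly A)"
    unfolding sum.atMost_Suc_shift add.IH by (simp add: smult_sum_right smult_monom)
  \<comment> \<open>The top summand vanishes because \<open>elem_fps A\<close> has no coefficients
    beyond \<open>size A\<close>.\<close>
  also have "(\<Sum>k\<le>Suc ?m. monom (elem_fps A $ k) (Suc ?m - k)) = pCons 0 (roots_poly A)"
  proof -
    have "(\<Sum>k\<le>?m. monom (elem_fps A $ k) (Suc ?m - k)) = (\<Sum>k\<le>?m. pCons 0 (monom (elem_fps A $ k) (?m - k)))"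
      by (intro sum.cong refl) (simp add: Suc_diff_le monom_Suc)
    also have "\<dots> = pCons 0 (roots_poly A)"
      unfolding add.IH by (simp add: pCons_0_sum)
    finally show ?thesis by (simp add: elem_fps_nth_eq_0)
  qed
  finally show ?case by simp
qed simp

text \<open>The same expansion in evaluated form. The general algebra allows complex
  \<open>w\<close>, which is needed when a root of the limit polynomial is not yet known to be
  real.\<close>

lemma prod_diff_roots_eq:
  fixes w :: "'a :: {real_algebra_1, comm_ring_1}"
  shows "(\<Prod>x\<in>#A. w - of_real x) = (\<Sum>k\<le>size A. of_real (elem_fps A $ k) * w ^ (size A - k))"
proof (induction A)
  case (add x A)
  let ?m = "size A"
  have "(\<Sum>k\<le>Suc ?m. of_real (elem_fps (add_mset x A) $ k) * w ^ (Suc ?m - k))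
     = (\<Sum>k\<le>Suc ?m. of_real (elem_fps A $ k) * w ^ (Suc ?m - k))
       - (\<Sum>k\<le>Suc ?m. if k = 0 then 0 else of_real (x * elem_fps A $ (k - 1)) * w ^ (Suc ?m - k))"
    unfolding sum_subtractf[symmetric] 
    by (intro sum.cong refl) (simp add: elem_fps_nth_add algebra_simps del: elem_fps_add)
  also have "(\<Sum>k\<le>Suc ?m. if k = 0 then 0 else of_real (x * elem_fps A $ (k - 1)) * w ^ (Suc ?m - k))
     = of_real x * (\<Sum>k\<le>?m. of_real (elem_fps A $ k) * w ^ (?m - k))"
    unfolding sum.atMost_Suc_shift by (simp add: sum_distrib_left mult.assoc)
  also have "(\<Sum>k\<le>Suc ?m. of_real (elem_fps A $ k) * w ^ (Suc ?m - k))
     = w * (\<Sum>k\<le>?m. of_real (elem_fps A $ k) * w ^ (?m - k))"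
  proof -
    have "(\<Sum>k\<le>?m. of_real (elem_fps A $ k) * w ^ (Suc ?m - k)) = (\<Sum>k\<le>?m. w * (of_real (elem_fps A $ k) * w ^ (?m - k)))"
      by (intro sum.cong refl) (simp add: Suc_diff_le mult_ac)
    then show ?thesis by (simp add: elem_fps_nth_eq_0 sum_distrib_left)
  qed
  finally show ?case by (simp add: add.IH algebra_simps)
qed simp

section \<open>Convergence of real root multisets\<close>

text \<open>Newton's identity writes each coefficient as a fixed polynomial in earlier coefficients
  and power sums, so convergence passes on by strong induction.\<close>

lemma tendsto_elem_fps:
  assumes "\<And>k. k \<le> m \<Longrightarrow> \<exists>c. ((\<lambda>t. psum k (A t)) \<longlongrightarrow> c) F" "k \<le> m"
  shows "\<exists>c. ((\<lambda>t. elem_fps (A t) $ k) \<longlongrightarrow> c) F"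
  using assms(2)
proof (induction k rule: less_induct)
  case (less k)
  show ?case
  proof (cases k)
    case 0
    then show ?thesis by (auto intro: exI[of _ 1])
  next
    case (Suc l)
    have "\<exists>e. \<forall>j\<in>{0..l}. ((\<lambda>t. elem_fps (A t) $ j) \<longlongrightarrow> e j) F"
      by (rule bchoice) (use less Suc in auto)
    then obtain e where e: "\<And>j. j \<le> l \<Longrightarrow> ((\<lambda>t. elem_fps (A t) $ j) \<longlongrightarrow> e j) F"
      by (metis atLeastAtMost_iff le0)
    have "\<exists>p. \<forall>j\<in>{..m}. ((\<lambda>t. psum j (A t)) \<longlongrightarrow> p j) F"
      by (rule bchoice) (use assms(1) in auto)
    then obtain p where p: "\<And>j. j \<le> m \<Longrightarrow> ((\<lambda>t. psum j (A t)) \<longlongrightarrow> p j) F"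
      by auto
    have "((\<lambda>t. - (\<Sum>j=0..l. elem_fps (A t) $ j * psum (Suc l - j) (A t)) / real (Suc l))
        \<longlongrightarrow> - (\<Sum>j=0..l. e j * p (Suc l - j)) / real (Suc l)) F"
      by (intro tendsto_intros e p) (use less.prems Suc in auto)
    then have "((\<lambda>t. elem_fps (A t) $ Suc l) \<longlongrightarrow> - (\<Sum>j=0..l. e j * p (Suc l - j)) / real (Suc l)) F"
      by (simp only: newton_identity[symmetric]) simp
    with Suc show ?thesis by auto
  qed
qed

lemma prod_mset_ge_power:
  fixes f :: "real \<Rightarrow> real"
  assumes "\<And>x. x \<in># A \<Longrightarrow> c \<le> f x" "0 \<le> c"
  shows "c ^ size A \<le> (\<Prod>x\<in>#A. f x)"
  using assms(1)
proof (induction A)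
  case (add x A)
  then have "c * c ^ size A \<le> f x * (\<Prod>x\<in>#A. f x)"
    using assms(2) order.trans[of 0 c "f x"] by (intro mult_mono) auto
  then show ?case by simp
qed simp

lemma norm_prod_mset_diff:
  fixes w :: complex
  shows "norm (\<Prod>x\<in>#A. w - of_real x) = (\<Prod>x\<in>#A. norm (w - of_real x))"
  by (induction A) (simp_all add: norm_mult)

text \<open>
  The limit polynomial has a complex root \<open>w\<close>. As each factor \<open>\<bar>w - x\<bar>\<close> is at least \<open>\<bar>Im w\<bar>\<close>, it is
  real, and the root nearest to \<open>w\<close> converges to it.
\<close>
lemma real_limit_root:
  assumes F: "F \<noteq> bot" and m: "m > 0"
    and size: "\<forall>\<^sub>F t in F. size (A t) = m"
    and lim: "\<And>k. k \<le> m \<Longrightarrow> \<exists>c. ((\<lambda>t. psum k (A t)) \<longlongrightarrow> c) F"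
  shows "\<exists>\<nu> u. (u \<longlongrightarrow> \<nu>) F \<and> (\<forall>\<^sub>F t in F. u t \<in># A t)"
proof -
  have "\<exists>e. \<forall>k\<in>{..m}. ((\<lambda>t. elem_fps (A t) $ k) \<longlongrightarrow> e k) F"
    by (rule bchoice) (use tendsto_elem_fps lim in blast)
  then obtain e where e: "\<And>k. k \<le> m \<Longrightarrow> ((\<lambda>t. elem_fps (A t) $ k) \<longlongrightarrow> e k) F"
    by auto
  have e0: "e 0 = 1"
    using e[of 0] F by (simp add: tendsto_const_iff)
  \<comment> \<open>\<open>R\<close> is the coefficientwise limit of the monic polynomials with root
    multisets \<open>A t\<close>. Its coefficient at \<open>m\<close> stays 1, so it is nonconstant
    and has a complex root.\<close>
  define R :: "complex poly" where "R = (\<Sum>k\<le>m. monom (of_real (e k)) (m - k))"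
  have "coeff R m = (\<Sum>k\<le>m. if k = 0 then 1 else 0)"
    unfolding R_def coeff_sum by (intro sum.cong) (auto simp: e0)
  then have "coeff R m = 1" by simp
  then have "degree R > 0" using m by (metis le_degree less_le_trans one_neq_zero)
  then have "\<not> constant (poly R)" by (simp add: constant_degree)
  then obtain w where w: "poly R w = 0" using fundamental_theorem_of_algebra by blast
  have lim_ev: "\<And>z. ((\<lambda>t. \<Prod>x\<in>#A t. z - complex_of_real x) \<longlongrightarrow> poly R z) F"
  proof -
    fix z :: complex
    have "((\<lambda>t. \<Sum>k\<le>m. of_real (elem_fps (A t) $ k) * z ^ (m - k)) \<longlongrightarrow>
        (\<Sum>k\<le>m. of_real (e k) * z ^ (m - k))) F"
      by (intro tendsto_intros e) auto
    also have "(\<Sum>k\<le>m. of_real (e k) * z ^ (m - k)) = poly R z"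
      by (simp add: R_def poly_sum poly_monom)
    finally show "((\<lambda>t. \<Prod>x\<in>#A t. z - complex_of_real x) \<longlongrightarrow> poly R z) F"
      by (rule Lim_transform_eventually) (use size in \<open>eventually_elim\<close>, simp add: prod_diff_roots_eq)
  qed
  have lim0: "((\<lambda>t. \<Prod>x\<in>#A t. norm (w - complex_of_real x)) \<longlongrightarrow> 0) F"
    using tendsto_norm[OF lim_ev[of w]] by (simp add: w norm_prod_mset_diff)
  have "\<bar>Im w\<bar> ^ m \<le> 0"
  proof (rule tendsto_lowerbound[OF lim0 _ F], use size in \<open>eventually_elim\<close>)
    fix t assume "size (A t) = m"
    moreover have "\<bar>Im w\<bar> ^ size (A t) \<le> (\<Prod>x\<in>#A t. norm (w - complex_of_real x))"
      by (rule prod_mset_ge_power) (use abs_Im_le_cmod[of "w - of_real x" for x] in auto)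
    ultimately show "\<bar>Im w\<bar> ^ m \<le> (\<Prod>x\<in>#A t. norm (w - complex_of_real x))" by simp
  qed
  then have "\<bar>Im w\<bar> ^ m = 0" using zero_le_power[of "\<bar>Im w\<bar>" m] by linarith
  then have Im0: "Im w = 0" by simp
  define \<nu> where "\<nu> = Re w"
  have w': "w = of_real \<nu>" using Im0 by (simp add: \<nu>_def complex_eq_iff)
  have lim1: "((\<lambda>t. \<Prod>x\<in>#A t. \<bar>\<nu> - x\<bar>) \<longlongrightarrow> 0) F"
    using lim0 by (simp add: w' flip: of_real_diff)
  \<comment> \<open>The smallest of \<open>m\<close> distances, raised to the power
    \<open>m\<close>, is at most their product, and that product tends to 0.\<close>
  have ex: "\<exists>u. u \<in># A t \<and> \<bar>\<nu> - u\<bar> ^ m \<le> (\<Prod>x\<in>#A t. \<bar>\<nu> - x\<bar>)" if "size (A t) = m" for t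
  proof -
    define c where "c = Min ((\<lambda>x. \<bar>\<nu> - x\<bar>) ` set_mset (A t))"
    have ne: "set_mset (A t) \<noteq> {}" using that m by auto
    then have "c \<in> (\<lambda>x. \<bar>\<nu> - x\<bar>) ` set_mset (A t)" unfolding c_def by (intro Min_in) auto
    then obtain u where u: "u \<in># A t" "c = \<bar>\<nu> - u\<bar>" by auto
    have "\<And>x. x \<in># A t \<Longrightarrow> c \<le> \<bar>\<nu> - x\<bar>" unfolding c_def by auto
    then have "c ^ size (A t) \<le> (\<Prod>x\<in>#A t. \<bar>\<nu> - x\<bar>)"
      using u by (intro prod_mset_ge_power) auto
    with u that show ?thesis by auto
  qed
  define u where "u t = (SOME u. u \<in># A t \<and> \<bar>\<nu> - u\<bar> ^ m \<le> (\<Prod>x\<in>#A t. \<bar>\<nu> - x\<bar>))" for t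
  have u: "\<forall>\<^sub>F t in F. u t \<in># A t \<and> \<bar>\<nu> - u t\<bar> ^ m \<le> (\<Prod>x\<in>#A t. \<bar>\<nu> - x\<bar>)"
    using size by eventually_elim (use someI_ex[OF ex] in \<open>auto simp: u_def\<close>)
  have "((\<lambda>t. \<bar>\<nu> - u t\<bar> ^ m) \<longlongrightarrow> 0) F"
    by (rule tendsto_sandwich[OF _ _ tendsto_const lim1]) (use u in \<open>auto elim: eventually_mono\<close>)
  then have "((\<lambda>t. root m (\<bar>\<nu> - u t\<bar> ^ m)) \<longlongrightarrow> root m 0) F"
    by (rule tendsto_real_root)
  then have "((\<lambda>t. \<nu> - u t) \<longlongrightarrow> 0) F"
    using m by (simp add: real_root_power_cancel tendsto_rabs_zero_iff)
  then have "((\<lambda>t. \<nu> - (\<nu> - u t)) \<longlongrightarrow> \<nu> - 0) F" by (intro tendsto_intros)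
  then have "(u \<longlongrightarrow> \<nu>) F" by simp
  moreover have "\<forall>\<^sub>F t in F. u t \<in># A t" using u by eventually_elim auto
  ultimately show ?thesis by blast
qed

text \<open>Convergent roots are split off one at a time: the power sums of the remaining multiset
  are differences of convergent functions, so \<open>real_limit_root\<close> applies again.\<close>

lemma tendsto_enumeration:
  assumes F: "F \<noteq> bot"
    and size: "\<forall>\<^sub>F t in F. size (A t) = m"
    and lim: "\<And>k. k \<le> m \<Longrightarrow> \<exists>c. ((\<lambda>t. psum k (A t)) \<longlongrightarrow> c) F"
  shows "\<exists>V. size V = m \<and> (\<forall>v\<in>#V. \<exists>c. (v \<longlongrightarrow> c) F) \<and>
           (\<forall>\<^sub>F t in F. A t = image_mset (\<lambda>v. v t) V)"
  using size lim
proof (induction m arbitrary: A)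
  case 0
  then show ?case by (intro exI[of _ "{#}"]) auto
next
  case (Suc m)
  obtain \<nu> u where u: "(u \<longlongrightarrow> \<nu>) F" "\<forall>\<^sub>F t in F. u t \<in># A t"
    using real_limit_root[OF F _ Suc.prems] by auto
  define B where "B t = A t - {#u t#}" for t
  have AB: "\<forall>\<^sub>F t in F. A t = add_mset (u t) (B t)"
    using u(2) by eventually_elim (simp add: B_def)
  have "\<exists>c. ((\<lambda>t. psum k (B t)) \<longlongrightarrow> c) F" if "k \<le> m" for k
  proof -
    obtain c where "((\<lambda>t. psum k (A t)) \<longlongrightarrow> c) F" using Suc.prems(2) \<open>k \<le> m\<close> le_SucI by blast
    then have "((\<lambda>t. psum k (A t) - u t ^ k) \<longlongrightarrow> c - \<nu> ^ k) F" by (intro tendsto_intros u)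
    then have "((\<lambda>t. psum k (B t)) \<longlongrightarrow> c - \<nu> ^ k) F"
      by (rule Lim_transform_eventually) (use AB in \<open>eventually_elim\<close>, simp)
    then show ?thesis by blast
  qed
  moreover have "\<forall>\<^sub>F t in F. size (B t) = m"
    using AB Suc.prems(1) by eventually_elim simp
  ultimately obtain V where V: "size V = m" "\<forall>v\<in>#V. \<exists>c. (v \<longlongrightarrow> c) F"
     "\<forall>\<^sub>F t in F. B t = image_mset (\<lambda>v. v t) V"
    using Suc.IH[of B] by blast
  have "\<forall>\<^sub>F t in F. A t = image_mset (\<lambda>v. v t) (add_mset u V)"
    using AB V(3) by eventually_elim simp
  with V u(1) show ?case by (intro exI[of _ "add_mset u V"]) auto
qed

section \<open>Tangent cones of branches\<close>

text \<open>The vertical distance, at time \<open>t\<close>, of \<open>y\<close> from the line of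
  slope \<open>d\<close> through the point \<open>(b, m)\<close>.\<close>

definition dev :: "real \<Rightarrow> real \<Rightarrow> real \<Rightarrow> real \<Rightarrow> real \<Rightarrow> real" where
  "dev b m d t y = \<bar>y - m - d * (t - b)\<bar>"

text \<open>Differentiability is asked at the single point \<open>b\<close> only; elsewhere the
  members of \<open>Z\<close> may even be discontinuous. This is what the analysis at one point
  provides.\<close>

definition branches_at :: "(real \<Rightarrow> real) set \<Rightarrow> (real \<Rightarrow> real set) \<Rightarrow> real \<Rightarrow> bool" where
  "branches_at Z L b \<longleftrightarrow> finite Z \<and> Z \<noteq> {} \<and> (\<forall>z\<in>Z. z differentiable at b) \<and>
     (\<forall>\<^sub>F t in nhds b. L t = (\<lambda>z. z t) ` Z)"

text \<open>All values of \<open>L\<close> are tangent at \<open>b\<close> to one common line,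
  uniformly. At \<open>t = b\<close> the estimate forces every value to be \<open>m\<close>.\<close>

definition flat_at :: "(real \<Rightarrow> real set) \<Rightarrow> real \<Rightarrow> bool" where
  "flat_at L b \<longleftrightarrow> (\<exists>m d. \<forall>e>0. \<forall>\<^sub>F t in nhds b. \<forall>y\<in>L t. dev b m d t y \<le> e * \<bar>t - b\<bar>)"

lemma has_real_derivative_iff_dev:
  "(f has_real_derivative d) (at b within S) \<longleftrightarrow>
   (\<forall>e>0. \<forall>\<^sub>F t in at b within S. dev b (f b) d t (f t) \<le> e * \<bar>t - b\<bar>)"
  by (simp add: has_field_derivative_def has_derivative_within_alt2 bounded_linear_mult_right dev_def)

lemma real_differentiableE:
  assumes "f differentiable at (b::real)"
  obtains d where "(f has_real_derivative d) (at b)"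
  using assms by (auto simp: real_differentiable_def)

lemma isCont_dev: "isCont f s \<Longrightarrow> isCont (\<lambda>t. dev b m d t (f t)) s"
  unfolding dev_def by (intro continuous_intros)

text \<open>A branch is either tangent to the given line or leaves a cone around it: a different
  value at \<open>b\<close> keeps it at positive distance, and a different slope makes the distance
  grow linearly.\<close>

lemma cone_separation1:
  assumes "z differentiable at (b::real)"
  shows "\<exists>\<delta>>0. (z b = m \<and> (\<forall>e>0. \<forall>\<^sub>F t in at b. dev b m d t (z t) \<le> e * \<bar>t - b\<bar>)) \<or>
     (\<forall>\<^sub>F t in at b. dev b m d t (z t) > \<delta> * \<bar>t - b\<bar>)"
proof -
  obtain D where D: "(z has_real_derivative D) (at b)" using assms by (rule real_differentiableE)
  have cont: "isCont z b" using D by (rule DERIV_isCont)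
  consider "z b \<noteq> m" | "z b = m" "D = d" | "z b = m" "D \<noteq> d" by blast
  then show ?thesis
  proof cases
    case 1
    have "((\<lambda>t. dev b m d t (z t) - 1 * \<bar>t - b\<bar>) \<longlongrightarrow> dev b m d b (z b) - 1 * \<bar>b - b\<bar>) (at b)"
      using isCont_dev[OF cont] by (intro tendsto_intros) (auto simp: isCont_def)
    then have "\<forall>\<^sub>F t in at b. 0 < dev b m d t (z t) - 1 * \<bar>t - b\<bar>"
      by (rule order_tendstoD) (use 1 in \<open>auto simp: dev_def\<close>)
    then have "\<forall>\<^sub>F t in at b. 1 * \<bar>t - b\<bar> < dev b m d t (z t)"
      by eventually_elim simp
    then show ?thesis using zero_less_one by blast
  next
    case 2
    then show ?thesis using D by (auto simp: has_real_derivative_iff_dev intro!: exI[of _ 1])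
  next
    case 3
    \<comment> \<open>The branch follows its own tangent up to \<open>c / 4\<close> times the
      distance to \<open>b\<close>, so its deviation from the other line is at least three quarters
      of \<open>c\<close> times that distance, which exceeds the half.\<close>
    define c where "c = \<bar>D - d\<bar>"
    have c: "c > 0" using 3 by (simp add: c_def)
    have "\<forall>\<^sub>F t in at b. dev b m D t (z t) \<le> (c / 4) * \<bar>t - b\<bar>"
      using D[unfolded has_real_derivative_iff_dev 3(1), rule_format, of "c / 4"] c by simp
    moreover have "\<forall>\<^sub>F t in at b. t \<noteq> b" by (simp add: eventually_at_filter)
    ultimately have "\<forall>\<^sub>F t in at b. c / 2 * \<bar>t - b\<bar> < dev b m d t (z t)"
    proof eventually_elim
      case (elim t)
      have "c * \<bar>t - b\<bar> = \<bar>(D - d) * (t - b)\<bar>" by (simp add: c_def abs_mult)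
      also have "\<dots> \<le> dev b m d t (z t) + dev b m D t (z t)"
        unfolding dev_def using abs_triangle_ineq4[of "z t - m - d * (t - b)" "z t - m - D * (t - b)"]
        by (simp add: left_diff_distrib)
      finally have "c * \<bar>t - b\<bar> - c / 4 * \<bar>t - b\<bar> \<le> dev b m d t (z t)"
        using elim by linarith
      moreover have "0 < c * \<bar>t - b\<bar>" using c elim by simp
      ultimately show ?case by (simp add: algebra_simps)
    qed
    then show ?thesis using c by (intro exI[of _ "c / 2"]) simp
  qed
qed

lemma cone_separation:
  assumes "finite Z" "\<And>z. z \<in> Z \<Longrightarrow> z differentiable at (b::real)"
  shows "\<exists>\<delta>>0. \<forall>z\<in>Z. (z b = m \<and> (\<forall>e>0. \<forall>\<^sub>F t in at b. dev b m d t (z t) \<le> e * \<bar>t - b\<bar>)) \<or>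
     (\<forall>\<^sub>F t in at b. dev b m d t (z t) > \<delta> * \<bar>t - b\<bar>)"
  using assms
proof (induction Z)
  case empty
  then show ?case by (intro exI[of _ 1]) simp
next
  case (insert z Z)
  obtain \<delta> where \<delta>: "\<delta> > 0" "\<forall>z\<in>Z. (z b = m \<and> (\<forall>e>0. \<forall>\<^sub>F t in at b. dev b m d t (z t) \<le> e * \<bar>t - b\<bar>)) \<or>
     (\<forall>\<^sub>F t in at b. dev b m d t (z t) > \<delta> * \<bar>t - b\<bar>)"
    using insert by blast
  obtain \<delta>' where \<delta>': "\<delta>' > 0" "(z b = m \<and> (\<forall>e>0. \<forall>\<^sub>F t in at b. dev b m d t (z t) \<le> e * \<bar>t - b\<bar>)) \<or>
     (\<forall>\<^sub>F t in at b. dev b m d t (z t) > \<delta>' * \<bar>t - b\<bar>)"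
    using cone_separation1[of z b m d] insert.prems by blast
  have le: "min \<delta> \<delta>' * \<bar>t - b\<bar> \<le> \<delta> * \<bar>t - b\<bar>" "min \<delta> \<delta>' * \<bar>t - b\<bar> \<le> \<delta>' * \<bar>t - b\<bar>" for t
    by (auto intro: mult_right_mono)
  have mono: "\<forall>\<^sub>F t in at b. dev b m d t (w t) > min \<delta> \<delta>' * \<bar>t - b\<bar>"
    if "(\<forall>\<^sub>F t in at b. dev b m d t (w t) > \<delta> * \<bar>t - b\<bar>) \<or> (\<forall>\<^sub>F t in at b. dev b m d t (w t) > \<delta>' * \<bar>t - b\<bar>)" for w
    using that by (auto elim!: eventually_mono intro: le_less_trans le)
  show ?case
    by (rule exI[of _ "min \<delta> \<delta>'"]) (use \<delta> \<delta>' mono in auto)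
qed

text \<open>The condition speaks about the values of \<open>L\<close> and not about branches, so it
  applies to any selection, whichever branches it follows: no value lies on the boundary of the
  cone, and values inside are tangent to its axis.\<close>

definition tangent_cone :: "(real \<Rightarrow> real set) \<Rightarrow> real \<Rightarrow> real \<Rightarrow> real \<Rightarrow> real \<Rightarrow> bool" where
  "tangent_cone L b m d \<delta> \<longleftrightarrow> \<delta> > 0 \<and> (\<forall>\<^sub>F t in at b. \<forall>y\<in>L t. dev b m d t y \<noteq> \<delta> * \<bar>t - b\<bar>) \<and>
     (\<forall>e>0. \<forall>\<^sub>F t in at b. \<forall>y\<in>L t. dev b m d t y < \<delta> * \<bar>t - b\<bar> \<longrightarrow> dev b m d t y \<le> e * \<bar>t - b\<bar>)"

lemma tangent_coneI:
  assumes \<delta>: "\<delta> > 0" and Z: "finite Z" "\<forall>\<^sub>F t in at b. L t = (\<lambda>z. z t) ` Z"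
    and sep: "\<forall>z\<in>Z. (z b = m \<and> (\<forall>e>0. \<forall>\<^sub>F t in at b. dev b m d t (z t) \<le> e * \<bar>t - b\<bar>)) \<or>
     (\<forall>\<^sub>F t in at b. dev b m d t (z t) > \<delta> * \<bar>t - b\<bar>)"
  shows "tangent_cone L b m d \<delta>"
proof -
  have *: "\<forall>\<^sub>F t in at b. \<forall>z\<in>Z. dev b m d t (z t) \<le> e * \<bar>t - b\<bar> \<or> dev b m d t (z t) > \<delta> * \<bar>t - b\<bar>"
    if "e > 0" for e
  proof (rule eventually_ball_finite[OF Z(1)], rule ballI)
    fix z assume "z \<in> Z"
    then consider "\<forall>\<^sub>F t in at b. dev b m d t (z t) \<le> e * \<bar>t - b\<bar>" | "\<forall>\<^sub>F t in at b. dev b m d t (z t) > \<delta> * \<bar>t - b\<bar>"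
      using sep \<open>e > 0\<close> by blast
    then show "\<forall>\<^sub>F t in at b. dev b m d t (z t) \<le> e * \<bar>t - b\<bar> \<or> dev b m d t (z t) > \<delta> * \<bar>t - b\<bar>"
      by cases (auto elim: eventually_mono)
  qed
  have ne: "\<forall>\<^sub>F t in at b. t \<noteq> b" by (simp add: eventually_at_filter)
  \<comment> \<open>Taking \<open>e\<close> as half of \<delta> leaves a gap between the values
    inside the cone and its boundary.\<close>
  have "\<forall>\<^sub>F t in at b. \<forall>y\<in>L t. dev b m d t y \<noteq> \<delta> * \<bar>t - b\<bar>"
    using *[OF half_gt_zero[OF \<delta>]] Z(2) ne
  proof eventually_elim
    case (elim t)
    then have "\<delta> * \<bar>t - b\<bar> > 0" using \<delta> by simp
    moreover have "dev b m d t (z t) \<le> \<delta> * \<bar>t - b\<bar> / 2 \<or> dev b m d t (z t) > \<delta> * \<bar>t - b\<bar>" if "z \<in> Z" for z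
      using elim(1) that by auto
    ultimately have "dev b m d t (z t) \<noteq> \<delta> * \<bar>t - b\<bar>" if "z \<in> Z" for z
      using that by (smt (verit) field_sum_of_halves)
    then show ?case using elim(2) by auto
  qed
  moreover have "\<forall>\<^sub>F t in at b. \<forall>y\<in>L t. dev b m d t y < \<delta> * \<bar>t - b\<bar> \<longrightarrow> dev b m d t y \<le> e * \<bar>t - b\<bar>" if "e > 0" for e
    using *[OF that] Z(2) by eventually_elim force
  ultimately show ?thesis using \<delta> by (simp add: tangent_cone_def)
qed

text \<open>A continuous selection on an interval ending at \<open>b\<close> cannot cross the
  boundary of the cone of a branch. Close to \<open>b\<close> it therefore stays in the cone of a
  branch that it meets at one time, and inherits that branch's value and slope as its
  limits.\<close>

lemma selection_limit:
  fixes f :: "real \<Rightarrow> real"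
  assumes Z: "branches_at Z L b" and J: "connected J" "b \<in> closure J" "b \<notin> J"
    and f: "\<And>t. t \<in> J \<Longrightarrow> f t \<in> L t" "\<And>t. t \<in> J \<Longrightarrow> isCont f t"
  shows "\<exists>z\<in>Z. \<forall>d. (z has_real_derivative d) (at b) \<longrightarrow>
           (\<forall>e>0. \<forall>\<^sub>F t in at b within J. dev b (z b) d t (f t) \<le> e * \<bar>t - b\<bar>)"
proof -
  have fin: "finite Z" and diff: "\<And>z. z \<in> Z \<Longrightarrow> z differentiable at b"
    and L: "\<forall>\<^sub>F t in at b. L t = (\<lambda>z. z t) ` Z"
    using Z by (auto simp: branches_at_def eventually_nhds_conv_at)
  have "\<exists>D. \<forall>z\<in>Z. (z has_real_derivative D z) (at b)"
    by (rule bchoice) (use diff in \<open>auto simp: real_differentiable_def\<close>)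
  then obtain D where D: "\<And>z. z \<in> Z \<Longrightarrow> (z has_real_derivative D z) (at b)" by blast
  have "\<exists>\<delta>. \<forall>z\<in>Z. tangent_cone L b (z b) (D z) (\<delta> z)"
  proof (rule bchoice, rule ballI)
    fix z assume "z \<in> Z"
    show "\<exists>\<delta>. tangent_cone L b (z b) (D z) \<delta>"
      using cone_separation[OF fin diff, of "z b" "D z"] tangent_coneI[OF _ fin L] by blast
  qed
  then obtain \<delta> where \<delta>: "\<And>z. z \<in> Z \<Longrightarrow> tangent_cone L b (z b) (D z) (\<delta> z)" by blast
  have "\<forall>\<^sub>F t in at b. \<forall>z\<in>Z. (\<forall>y\<in>L t. dev b (z b) (D z) t y \<noteq> \<delta> z * \<bar>t - b\<bar>) \<and>
      dev b (z b) (D z) t (z t) < \<delta> z * \<bar>t - b\<bar>"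
  proof (rule eventually_ball_finite[OF fin], rule ballI)
    fix z assume z: "z \<in> Z"
    have ne: "\<forall>\<^sub>F t in at b. t \<noteq> b" by (simp add: eventually_at_filter)
    have pos: "\<delta> z > 0" using \<delta>[OF z] by (simp add: tangent_cone_def)
    then have "\<forall>\<^sub>F t in at b. dev b (z b) (D z) t (z t) \<le> (\<delta> z / 2) * \<bar>t - b\<bar>"
      using D[OF z] unfolding has_real_derivative_iff_dev by (meson half_gt_zero)
    then have "\<forall>\<^sub>F t in at b. dev b (z b) (D z) t (z t) < \<delta> z * \<bar>t - b\<bar>"
      using ne
    proof eventually_elim
      case (elim t)
      then have "\<delta> z * \<bar>t - b\<bar> > 0" using pos by simp
      with elim show ?case by simp
    qed
    then show "\<forall>\<^sub>F t in at b. (\<forall>y\<in>L t. dev b (z b) (D z) t y \<noteq> \<delta> z * \<bar>t - b\<bar>) \<and>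
      dev b (z b) (D z) t (z t) < \<delta> z * \<bar>t - b\<bar>"
      using \<delta>[OF z] by (auto simp: tangent_cone_def eventually_conj_iff)
  qed
  with L have "\<forall>\<^sub>F t in at b. L t = (\<lambda>z. z t) ` Z \<and> (\<forall>z\<in>Z. (\<forall>y\<in>L t. dev b (z b) (D z) t y \<noteq> \<delta> z * \<bar>t - b\<bar>) \<and>
      dev b (z b) (D z) t (z t) < \<delta> z * \<bar>t - b\<bar>)"
    by (rule eventually_conj)
  then obtain \<epsilon> where \<epsilon>: "\<epsilon> > 0" and near: "\<And>t. t \<noteq> b \<Longrightarrow> dist t b < \<epsilon> \<Longrightarrow> L t = (\<lambda>z. z t) ` Z"
     "\<And>t z y. t \<noteq> b \<Longrightarrow> dist t b < \<epsilon> \<Longrightarrow> z \<in> Z \<Longrightarrow> y \<in> L t \<Longrightarrow> dev b (z b) (D z) t y \<noteq> \<delta> z * \<bar>t - b\<bar>"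
     "\<And>t z. t \<noteq> b \<Longrightarrow> dist t b < \<epsilon> \<Longrightarrow> z \<in> Z \<Longrightarrow> dev b (z b) (D z) t (z t) < \<delta> z * \<bar>t - b\<bar>"
    unfolding eventually_at by blast
  define K where "K = J \<inter> ball b \<epsilon>"
  have K: "connected K" unfolding K_def
    using J(1) by (intro convex_connected convex_Int) (auto simp: is_interval_convex_1[symmetric] is_interval_connected_1)
  have Kb: "t \<noteq> b" "dist t b < \<epsilon>" "t \<in> J" if "t \<in> K" for t
    using that J(3) by (auto simp: K_def dist_commute)
  obtain s where s: "s \<in> K"
    using J(2) \<epsilon> by (auto simp: K_def closure_approachable dist_commute)
  obtain z where z: "z \<in> Z" "f s = z s" using f(1)[of s] near(1)[of s] Kb[OF s] by auto
  \<comment> \<open>\<open>g\<close> is negative inside the cone of \<open>z\<close> and zero on its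
    boundary. It is negative at \<open>s\<close>, where \<open>f\<close> meets \<open>z\<close>, and
    has no zero on the connected set \<open>K\<close>, so it stays negative there.\<close>
  define g where "g t = dev b (z b) (D z) t (f t) - \<delta> z * \<bar>t - b\<bar>" for t
  have g0: "g t \<noteq> 0" if "t \<in> K" for t
    using near(2)[of t z "f t"] z(1) f(1)[of t] Kb[OF that] by (simp add: g_def)
  have gs: "g s < 0" using near(3)[of s z] z Kb[OF s] by (simp add: g_def)
  have "continuous_on K g"
    unfolding g_def by (intro continuous_at_imp_continuous_on ballI continuous_intros isCont_dev f(2) Kb(3))
  then have gK: "connected (g ` K)" using K by (rule connected_continuous_image)
  have neg: "g t < 0" if t: "t \<in> K" for t
  proof (rule ccontr)
    assume "\<not> g t < 0"
    moreover have "{g s..g t} \<subseteq> g ` K"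
      using s t by (intro connected_contains_Icc[OF gK] imageI)
    ultimately have "0 \<in> g ` K" using gs by auto
    then show False using g0 by auto
  qed
  have inK: "\<forall>\<^sub>F t in at b within J. t \<in> K"
    using \<epsilon> unfolding K_def eventually_at by (intro exI[of _ \<epsilon>]) (auto simp: dist_commute)
  have "\<forall>\<^sub>F t in at b within J. dev b (z b) (D z) t (f t) \<le> e * \<bar>t - b\<bar>" if "e > 0" for e
  proof -
    have "\<forall>\<^sub>F t in at b within J. \<forall>y\<in>L t. dev b (z b) (D z) t y < \<delta> z * \<bar>t - b\<bar> \<longrightarrow> dev b (z b) (D z) t y \<le> e * \<bar>t - b\<bar>"
      using \<delta>[OF z(1)] that at_le[of J UNIV b] unfolding tangent_cone_def by (meson filter_leD subset_UNIV)
    then show ?thesis using inK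
    proof eventually_elim
      case (elim t)
      then show ?case using neg[of t] f(1)[of t] Kb(3)[of t] by (auto simp: g_def)
    qed
  qed
  moreover have "d = D z" if "(z has_real_derivative d) (at b)" for d
    using DERIV_unique[OF that D[OF z(1)]] .
  ultimately show ?thesis using z(1) by blast
qed

text \<open>An interval \<open>J\<close> ending at \<open>b\<close> fills one side of every small
  ball around \<open>b\<close> and misses the other side. What remains is an open half-interval, on
  which a prolongation can be prescribed freely. The radius bound is the distance from
  \<open>b\<close> to some point of \<open>J\<close>.\<close>

lemma open_side_ball:
  fixes J :: "real set"
  assumes "connected J" "b \<in> closure J" "b \<notin> J"
  shows "\<exists>\<epsilon>0>0. \<forall>\<epsilon>. 0 < \<epsilon> \<and> \<epsilon> \<le> \<epsilon>0 \<longrightarrow> open (ball b \<epsilon> - J - {b})"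
proof -
  have ivl: "x \<in> J" if "u \<in> J" "v \<in> J" "u \<le> x" "x \<le> v" for u v x
    using connected_contains_Icc[OF assms(1) that(1,2)] that by auto
  have close: "\<exists>s\<in>J. \<bar>s - b\<bar> < e" if "e > 0" for e
    using assms(2) that by (auto simp: closure_approachable dist_real_def)
  obtain u where u: "u \<in> J" using close[of 1] by auto
  then consider "u < b" | "u > b" using assms(3) by fastforce
  then show ?thesis
  proof cases
    case 1
    have "ball b \<epsilon> - J - {b} = {b<..<b + \<epsilon>}" if "0 < \<epsilon>" "\<epsilon> \<le> b - u" for \<epsilon>
    proof (intro equalityI subsetI)
      fix t assume t: "t \<in> ball b \<epsilon> - J - {b}"
      have "\<not> t < b"
      proof
        assume "t < b"
        then obtain s where "s \<in> J" "\<bar>s - b\<bar> < b - t" using close[of "b - t"] by auto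
        then have "t \<in> J" using t that by (intro ivl[OF u \<open>s \<in> J\<close>]) (auto simp: dist_real_def)
        then show False using t by simp
      qed
      then show "t \<in> {b<..<b + \<epsilon>}" using t by (auto simp: dist_real_def)
    next
      fix t assume "t \<in> {b<..<b + \<epsilon>}"
      then show "t \<in> ball b \<epsilon> - J - {b}" using ivl[OF u, of t b] assms(3) 1 by (auto simp: dist_real_def)
    qed
    then show ?thesis using 1 by (intro exI[of _ "b - u"]) auto
  next
    case 2
    have "ball b \<epsilon> - J - {b} = {b - \<epsilon><..<b}" if "0 < \<epsilon>" "\<epsilon> \<le> u - b" for \<epsilon>
    proof (intro equalityI subsetI)
      fix t assume t: "t \<in> ball b \<epsilon> - J - {b}"
      have "\<not> t > b"
      proof
        assume "t > b"
        then obtain s where "s \<in> J" "\<bar>s - b\<bar> < t - b" using close[of "t - b"] by auto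
        then have "t \<in> J" using t that u by (intro ivl[OF \<open>s \<in> J\<close> u]) (auto simp: dist_real_def)
        then show False using t by simp
      qed
      then show "t \<in> {b - \<epsilon><..<b}" using t by (auto simp: dist_real_def)
    next
      fix t assume "t \<in> {b - \<epsilon><..<b}"
      then show "t \<in> ball b \<epsilon> - J - {b}" using ivl[OF _ u, of t b] assms(3) 2 by (auto simp: dist_real_def)
    qed
    then show ?thesis using 2 by (intro exI[of _ "u - b"]) auto
  qed
qed

section \<open>Differentiable selections\<close>

text \<open>Zorn's lemma gives a maximal partial selection whose domain \<open>J\<close> is open,
  connected and contains \<open>q\<close>. By \<open>ext\<close>, maximality forces \<open>J\<close>
  to be closed relative to \<open>V\<close>, so it contains the whole component.\<close>

lemma selection_on_component:
  fixes L :: "real \<Rightarrow> real set"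
  assumes loc: "\<And>b. b \<in> V \<Longrightarrow> \<exists>J f. open J \<and> connected J \<and> b \<in> J \<and> J \<subseteq> V \<and>
      (\<forall>t\<in>J. f t \<in> L t \<and> f differentiable at t)"
    and ext: "\<And>J f b. open J \<Longrightarrow> connected J \<Longrightarrow> J \<subseteq> V \<Longrightarrow> \<forall>t\<in>J. f t \<in> L t \<and> f differentiable at t \<Longrightarrow>
      b \<in> V \<Longrightarrow> b \<in> closure J \<Longrightarrow> b \<notin> J \<Longrightarrow>
      \<exists>J' f'. open J' \<and> connected J' \<and> J \<subseteq> J' \<and> b \<in> J' \<and> J' \<subseteq> V \<and> (\<forall>t\<in>J. f' t = f t) \<and>
        (\<forall>t\<in>J'. f' t \<in> L t \<and> f' differentiable at t)"
    and q: "q \<in> V"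
  shows "\<exists>x. \<forall>t\<in>connected_component_set V q. x t \<in> L t \<and> x differentiable at t"
proof -
  define good where "good J f \<longleftrightarrow> open J \<and> connected J \<and> q \<in> J \<and> J \<subseteq> V \<and> (\<forall>t\<in>J. f t \<in> L t \<and> f differentiable at t)"
    for J :: "real set" and f :: "real \<Rightarrow> real"
  define graph where "graph J f = (\<lambda>t. (t, f t)) ` J" for J :: "real set" and f :: "real \<Rightarrow> real"
  \<comment> \<open>Partial selections are ordered by inclusion of their graphs.\<close>
  define A where "A = {graph J f |J f. good J f}"
  have graph_sub: "J \<subseteq> J' \<and> (\<forall>t\<in>J. f' t = f t)" if "graph J f \<subseteq> graph J' f'" for J J' f f'
    using that by (auto simp: graph_def)
  have "\<exists>M\<in>A. \<forall>X\<in>A. M \<subseteq> X \<longrightarrow> X = M"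
  proof (rule subset_Zorn_nonempty)
    show "A \<noteq> {}" using loc[OF q] by (auto simp: A_def good_def)
  next
    fix \<C> assume ne: "\<C> \<noteq> {}" and chain: "subset.chain A \<C>"
    then have sub: "\<C> \<subseteq> A" and lin: "\<And>X Y. X \<in> \<C> \<Longrightarrow> Y \<in> \<C> \<Longrightarrow> X \<subseteq> Y \<or> Y \<subseteq> X"
      by (auto simp: subset_chain_def)
    \<comment> \<open>The union of the chain is again a graph, since any two of its points lie in a
      common member.\<close>
    define f where "f t = (THE y. (t, y) \<in> \<Union>\<C>)" for t
    have single: "y = y'" if h: "(t, y) \<in> \<Union>\<C>" "(t, y') \<in> \<Union>\<C>" for t y y'
    proof -
      obtain X Y where "X \<in> \<C>" "Y \<in> \<C>" "(t, y) \<in> X" "(t, y') \<in> Y" using h by blast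
      then obtain Z where "Z \<in> \<C>" "(t, y) \<in> Z" "(t, y') \<in> Z" using lin by blast
      then show ?thesis using sub by (auto simp: A_def graph_def)
    qed
    have f: "f t = y" if "(t, y) \<in> \<Union>\<C>" for t y
      unfolding f_def using that single by (intro the_equality) auto
    have UC: "\<Union>\<C> = graph (fst ` \<Union>\<C>) f"
      unfolding graph_def using f by force
    have member: "\<exists>J g. good J g \<and> J \<subseteq> fst ` \<Union>\<C> \<and> X = graph J g \<and> (\<forall>t\<in>J. f t = g t)" if X: "X \<in> \<C>" for X
    proof -
      obtain J g where J: "good J g" "X = graph J g" using X sub by (auto simp: A_def)
      have mem: "(t, g t) \<in> \<Union>\<C>" if "t \<in> J" for t using X J(2) that by (auto simp: graph_def)
      have "J \<subseteq> fst ` \<Union>\<C>" using mem by (metis fst_conv image_eqI subsetI)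
      moreover have "\<forall>t\<in>J. f t = g t" using f mem by blast
      ultimately show ?thesis using J by blast
    qed
    have Un: "fst ` \<Union>\<C> = \<Union>((`) fst ` \<C>)" by auto
    have fst_graph: "fst ` graph J g = J" for J g by (auto simp: graph_def image_image)
    have mem': "open (fst ` X) \<and> connected (fst ` X) \<and> q \<in> fst ` X \<and> fst ` X \<subseteq> V" if X: "X \<in> \<C>" for X
    proof -
      obtain J g where "good J g" "X = graph J g" using member[OF X] by blast
      then show ?thesis by (simp add: good_def fst_graph)
    qed
    have "good (fst ` \<Union>\<C>) f"
      unfolding good_def
    proof (intro conjI ballI)
      show "open (fst ` \<Union>\<C>)" unfolding Un using mem' by (intro open_Union) blast
      show "connected (fst ` \<Union>\<C>)" unfolding Un
        by (rule connected_Union) (use mem' in blast)+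
      show "q \<in> fst ` \<Union>\<C>" unfolding Un using mem' ne by blast
      show "fst ` \<Union>\<C> \<subseteq> V" unfolding Un using mem' by blast
    next
      fix t assume "t \<in> fst ` \<Union>\<C>"
      then obtain X where X: "X \<in> \<C>" "t \<in> fst ` X" by auto
      obtain J g where J: "good J g" "X = graph J g" "\<forall>t\<in>J. f t = g t" using member[OF X(1)] by blast
      have t: "t \<in> J" using X(2) J(2) fst_graph by simp
      show "f t \<in> L t" using J t by (auto simp: good_def)
      have "\<forall>\<^sub>F s in nhds t. f s = g s"
        using J(1,3) t by (auto simp: eventually_nhds good_def)
      moreover obtain d where "(g has_real_derivative d) (at t)"
        using J(1) t by (auto simp: good_def real_differentiable_def)
      ultimately have "(f has_real_derivative d) (at t)" by (subst DERIV_cong_ev[OF refl _ refl])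
      then show "f differentiable at t" by (auto simp: real_differentiable_def)
    qed
    then show "\<Union>\<C> \<in> A" using UC unfolding A_def by blast
  qed
  then obtain M where M: "M \<in> A" "\<And>X. X \<in> A \<Longrightarrow> M \<subseteq> X \<Longrightarrow> X = M" by blast
  from M(1) obtain J f where good: "good J f" and MJ: "M = graph J f" unfolding A_def by blast
  have max: "graph J' f' = graph J f" if "good J' f'" "graph J f \<subseteq> graph J' f'" for J' f'
    using M(2)[of "graph J' f'"] that unfolding MJ A_def by blast
  have J: "open J" "connected J" "q \<in> J" "J \<subseteq> V" "\<forall>t\<in>J. f t \<in> L t \<and> f differentiable at t"
    using good by (auto simp: good_def)
  have closed: "b \<in> J" if b: "b \<in> V" "b \<in> closure J" for b
  proof (rule ccontr)
    assume nb: "b \<notin> J"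
    obtain J' f' where J': "open J'" "connected J'" "J \<subseteq> J'" "b \<in> J'" "J' \<subseteq> V" "\<forall>t\<in>J. f' t = f t"
      "\<forall>t\<in>J'. f' t \<in> L t \<and> f' differentiable at t"
      using ext[OF J(1,2,4,5) b nb] by blast
    then have "good J' f'" using J(3) by (auto simp: good_def)
    moreover have "graph J f \<subseteq> graph J' f'"
    proof -
      have "graph J f = graph J f'" unfolding graph_def by (rule image_cong) (use J'(6) in auto)
      then show ?thesis using image_mono[OF J'(3)] by (simp add: graph_def)
    qed
    ultimately have "graph J' f' = graph J f" by (rule max)
    then have "J' \<subseteq> J" using graph_sub by blast
    then show False using J'(4) nb by blast
  qed
  define C where "C = connected_component_set V q"
  \<comment> \<open>On \<open>V\<close> the sets \<open>J\<close> and \<open>- closure J\<close> are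
    complementary open sets, so the connected set \<open>C\<close>, which meets \<open>J\<close>,
    lies in \<open>J\<close>.\<close>
  have "C \<subseteq> J"
  proof -
    have "connected C" "C \<subseteq> V" "q \<in> C" by (auto simp: C_def q connected_component_subset)
    moreover from this have "- closure J \<inter> C = {} \<or> J \<inter> C = {}"
      using closed closure_subset[of J] by (intro connectedD[OF _ _ J(1)]) (auto simp: open_Compl)
    ultimately show ?thesis using \<open>q \<in> C\<close> J(3) \<open>C \<subseteq> V\<close> closed by blast
  qed
  then show ?thesis using J(5) unfolding C_def by blast
qed

text \<open>If no branch left the cone, all of them would be tangent to its axis, and
  \<open>L\<close> would be flat at \<open>b\<close>.\<close>

lemma outside_branch:
  assumes Z: "branches_at Z L b" and nflat: "\<not> flat_at L b"
    and sep: "\<forall>z'\<in>Z. (z' b = m \<and> (\<forall>e>0. \<forall>\<^sub>F t in at b. dev b m d t (z' t) \<le> e * \<bar>t - b\<bar>)) \<or>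
     (\<forall>\<^sub>F t in at b. dev b m d t (z' t) > \<delta> * \<bar>t - b\<bar>)"
  shows "\<exists>z'\<in>Z. \<forall>\<^sub>F t in at b. dev b m d t (z' t) > \<delta> * \<bar>t - b\<bar>"
proof (rule ccontr)
  assume nex: "\<not> ?thesis"
  have fin: "finite Z" and LZ: "\<forall>\<^sub>F t in nhds b. L t = (\<lambda>z. z t) ` Z"
    using Z by (auto simp: branches_at_def)
  from nex have all: "\<And>z'. z' \<in> Z \<Longrightarrow> z' b = m \<and> (\<forall>e>0. \<forall>\<^sub>F t in at b. dev b m d t (z' t) \<le> e * \<bar>t - b\<bar>)"
    using sep by blast
  have "\<forall>\<^sub>F t in nhds b. \<forall>y\<in>L t. dev b m d t y \<le> e * \<bar>t - b\<bar>" if "e > 0" for e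
  proof -
    have "\<forall>\<^sub>F t in nhds b. \<forall>z'\<in>Z. dev b m d t (z' t) \<le> e * \<bar>t - b\<bar>"
    proof (intro eventually_ball_finite fin ballI)
      fix z' assume "z' \<in> Z"
      then have "\<forall>\<^sub>F t in at b. dev b m d t (z' t) \<le> e * \<bar>t - b\<bar>" "z' b = m"
        using all that by blast+
      then show "\<forall>\<^sub>F t in nhds b. dev b m d t (z' t) \<le> e * \<bar>t - b\<bar>"
        by (simp add: eventually_nhds_conv_at) (simp add: dev_def)
    qed
    then show ?thesis using LZ by eventually_elim auto
  qed
  then show False using nflat unfolding flat_at_def by blast
qed

text \<open>On a punctured ball, restrict \<open>L\<close> to the cone around the tangent of
  \<open>z\<close>. Some branch \<open>z'\<close> runs outside, so fewer branches remain and the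
  induction hypothesis \<open>IH\<close> applies. Whatever selection it returns stays in the cone
  and is thus tangent to \<open>z\<close> at \<open>b\<close>.\<close>

lemma local_selection:
  assumes IH: "\<And>U L. open U \<Longrightarrow> (\<forall>t\<in>U. \<exists>Z. card Z \<le> n \<and> branches_at Z L t) \<Longrightarrow>
      \<exists>x::real\<Rightarrow>real. \<forall>t\<in>U. x t \<in> L t \<and> x differentiable at t"
    and U: "open U" "b \<in> U" "\<forall>t\<in>U. \<exists>Z. card Z \<le> Suc n \<and> branches_at Z L t"
    and nflat: "\<not> flat_at L b" and Z: "branches_at Z L b"
    and z: "z \<in> Z" "(z has_real_derivative d) (at b)"
  shows "\<exists>\<epsilon>>0. \<exists>x. x b = z b \<and> (x has_real_derivative d) (at b) \<and>
     (\<forall>t\<in>ball b \<epsilon>. x t \<in> L t \<and> x differentiable at t)"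
proof -
  have fin: "finite Z" and diff: "\<And>z. z \<in> Z \<Longrightarrow> z differentiable at b"
    and LZ: "\<forall>\<^sub>F t in nhds b. L t = (\<lambda>z. z t) ` Z"
    using Z by (auto simp: branches_at_def)
  then have L: "\<forall>\<^sub>F t in at b. L t = (\<lambda>z. z t) ` Z" by (auto simp: eventually_nhds_conv_at)
  obtain \<delta> where \<delta>: "\<delta> > 0" and sep: "\<forall>z'\<in>Z. (z' b = z b \<and> (\<forall>e>0. \<forall>\<^sub>F t in at b. dev b (z b) d t (z' t) \<le> e * \<bar>t - b\<bar>)) \<or>
     (\<forall>\<^sub>F t in at b. dev b (z b) d t (z' t) > \<delta> * \<bar>t - b\<bar>)"
    using cone_separation[OF fin diff, of "z b" d] by blast
  have cone: "tangent_cone L b (z b) d \<delta>" by (rule tangent_coneI[OF \<delta> fin L sep])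
  have "\<exists>z'\<in>Z. \<forall>\<^sub>F t in at b. dev b (z b) d t (z' t) > \<delta> * \<bar>t - b\<bar>"
    by (rule outside_branch[OF Z nflat sep])
  then obtain z' where z': "z' \<in> Z" "\<forall>\<^sub>F t in at b. dev b (z b) d t (z' t) > \<delta> * \<bar>t - b\<bar>" by blast
  have ne: "\<forall>\<^sub>F t in at b. t \<noteq> b" by (simp add: eventually_at_filter)
  have "\<forall>\<^sub>F t in at b. dev b (z b) d t (z t) \<le> (\<delta> / 2) * \<bar>t - b\<bar>"
    using z(2) half_gt_zero[OF \<delta>] unfolding has_real_derivative_iff_dev by blast
  then have "\<forall>\<^sub>F t in at b. dev b (z b) d t (z t) < \<delta> * \<bar>t - b\<bar>"
    using ne
  proof eventually_elim
    case (elim t)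
    then have "\<delta> * \<bar>t - b\<bar> > 0" using \<delta> by simp
    with elim show ?case by simp
  qed
  moreover have "\<forall>\<^sub>F t in at b. \<forall>y\<in>L t. dev b (z b) d t y \<noteq> \<delta> * \<bar>t - b\<bar>"
    using cone by (simp add: tangent_cone_def)
  moreover have "\<forall>\<^sub>F t in at b. t \<in> U"
    using U(1,2) by (simp add: eventually_at_in_open')
  ultimately have "\<forall>\<^sub>F t in at b. t \<in> U \<and> L t = (\<lambda>z. z t) ` Z \<and> (\<forall>y\<in>L t. dev b (z b) d t y \<noteq> \<delta> * \<bar>t - b\<bar>)
      \<and> dev b (z b) d t (z t) < \<delta> * \<bar>t - b\<bar> \<and> dev b (z b) d t (z' t) > \<delta> * \<bar>t - b\<bar>"
    using L z'(2) by eventually_elim blast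
  then obtain \<epsilon> where \<epsilon>: "\<epsilon> > 0" and near: "\<And>t. t \<noteq> b \<Longrightarrow> dist t b < \<epsilon> \<Longrightarrow> t \<in> U \<and> L t = (\<lambda>z. z t) ` Z \<and> (\<forall>y\<in>L t. dev b (z b) d t y \<noteq> \<delta> * \<bar>t - b\<bar>)
      \<and> dev b (z b) d t (z t) < \<delta> * \<bar>t - b\<bar> \<and> dev b (z b) d t (z' t) > \<delta> * \<bar>t - b\<bar>"
    unfolding eventually_at by blast
  define W where "W = ball b \<epsilon> - {b}"
  define L' where "L' t = {y \<in> L t. dev b (z b) d t y < \<delta> * \<bar>t - b\<bar>}" for t
  have W: "open W" by (auto simp: W_def)
  have "\<exists>x. \<forall>t\<in>W. x t \<in> L' t \<and> x differentiable at t"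
  proof (rule IH[OF W], rule ballI)
    fix s assume s: "s \<in> W"
    have sW: "s \<noteq> b" "dist s b < \<epsilon>" using s by (auto simp: W_def dist_commute)
    obtain Y where Y: "card Y \<le> Suc n" "branches_at Y L s" using U(3) near[OF sW] by blast
    have Yfin: "finite Y" and Ydiff: "\<And>y. y \<in> Y \<Longrightarrow> y differentiable at s"
      and YL: "\<forall>\<^sub>F t in nhds s. L t = (\<lambda>z. z t) ` Y"
      using Y(2) by (auto simp: branches_at_def)
    have YLs: "L s = (\<lambda>z. z s) ` Y" using eventually_nhds_x_imp_x[OF YL] .
    \<comment> \<open>The branches \<open>Y\<close> belong to the time \<open>s\<close> and are
      unrelated to \<open>Z\<close>. Still, some member of \<open>Y\<close> takes the value
      \<open>z' s\<close> outside the cone, so the count drops, and some member takes the value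
      \<open>z s\<close> inside, so \<open>Y'\<close> is nonempty.\<close>
    define Y' where "Y' = {y \<in> Y. dev b (z b) d s (y s) < \<delta> * \<bar>s - b\<bar>}"
    have "z' s \<in> L s" "z s \<in> L s" using near[OF sW] z' z by auto
    then obtain y' y where "y' \<in> Y" "y' s = z' s" "y \<in> Y" "y s = z s" using YLs by auto
    then have y: "y' \<in> Y - Y'" "y \<in> Y'" using near[OF sW] by (auto simp: Y'_def)
    then have "Y' \<subset> Y" by (auto simp: Y'_def)
    from psubset_card_mono[OF Yfin this] have "card Y' \<le> n" using Y(1) by linarith
    moreover have "\<forall>\<^sub>F t in nhds s. L' t = (\<lambda>z. z t) ` Y'"
    proof -
      \<comment> \<open>Since no value at \<open>s\<close> lies on the boundary of the cone,
        continuity at \<open>s\<close> keeps each branch on its side.\<close>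
      have "\<forall>\<^sub>F t in nhds s. \<forall>y\<in>Y. (dev b (z b) d t (y t) < \<delta> * \<bar>t - b\<bar>) = (dev b (z b) d s (y s) < \<delta> * \<bar>s - b\<bar>)"
      proof (rule eventually_ball_finite[OF Yfin], rule ballI)
        fix y assume y: "y \<in> Y"
        define g where "g t = \<delta> * \<bar>t - b\<bar> - dev b (z b) d t (y t)" for t
        have "isCont y s" using Ydiff[OF y] by (simp add: differentiable_imp_continuous_within)
        then have "isCont g s" unfolding g_def by (intro continuous_intros isCont_dev)
        then have lim: "(g \<longlongrightarrow> g s) (nhds s)" by (simp add: continuous_at tendsto_at_iff_tendsto_nhds)
        have "g s \<noteq> 0" using near[OF sW] YLs y by (auto simp: g_def)
        then consider "g s > 0" | "g s < 0" by linarith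
        then have "\<forall>\<^sub>F t in nhds s. (g t > 0) = (g s > 0)"
        proof cases
          case 1
          then show ?thesis using order_tendstoD(1)[OF lim, of 0] by (auto elim: eventually_mono)
        next
          case 2
          then show ?thesis using order_tendstoD(2)[OF lim, of 0] by (auto elim!: eventually_mono)
        qed
        then show "\<forall>\<^sub>F t in nhds s. (dev b (z b) d t (y t) < \<delta> * \<bar>t - b\<bar>) = (dev b (z b) d s (y s) < \<delta> * \<bar>s - b\<bar>)"
          by (simp add: g_def)
      qed
      then show ?thesis using YL by eventually_elim (auto simp: L'_def Y'_def)
    qed
    ultimately show "\<exists>Z. card Z \<le> n \<and> branches_at Z L' s"
      using Yfin Ydiff y(2) by (intro exI[of _ Y']) (auto simp: branches_at_def Y'_def)
  qed
  then obtain x where x: "\<And>t. t \<in> W \<Longrightarrow> x t \<in> L' t" "\<And>t. t \<in> W \<Longrightarrow> x differentiable at t" by blast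
  define x' where "x' t = (if t = b then z b else x t)" for t
  have inW: "\<forall>\<^sub>F t in at b. t \<in> W"
    using \<epsilon> unfolding W_def eventually_at by (intro exI[of _ \<epsilon>]) (auto simp: dist_commute)
  have deriv: "(x' has_real_derivative d) (at b)"
    unfolding has_real_derivative_iff_dev
  proof (intro allI impI)
    fix e :: real assume "e > 0"
    then have "\<forall>\<^sub>F t in at b. \<forall>y\<in>L t. dev b (z b) d t y < \<delta> * \<bar>t - b\<bar> \<longrightarrow> dev b (z b) d t y \<le> e * \<bar>t - b\<bar>"
      using cone by (simp add: tangent_cone_def)
    then show "\<forall>\<^sub>F t in at b. dev b (x' b) d t (x' t) \<le> e * \<bar>t - b\<bar>"
      using inW by eventually_elim (use x(1) in \<open>auto simp: L'_def x'_def W_def\<close>)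
  qed
  have "x' t \<in> L t \<and> x' differentiable at t" if "t \<in> ball b \<epsilon>" for t
  proof (cases "t = b")
    case True
    then show ?thesis using deriv z(1) eventually_nhds_x_imp_x[OF LZ] by (auto simp: x'_def real_differentiable_def)
  next
    case False
    then have t: "t \<in> W" using that by (simp add: W_def)
    obtain c where "(x has_real_derivative c) (at t)" using x(2)[OF t] by (rule real_differentiableE)
    moreover have "\<forall>\<^sub>F s in nhds t. x' s = x s"
      using W t by (auto simp: eventually_nhds x'_def W_def intro!: exI[of _ W])
    ultimately have "(x' has_real_derivative c) (at t)" by (subst DERIV_cong_ev[OF refl _ refl])
    then show ?thesis using x(1)[OF t] False by (auto simp: x'_def L'_def real_differentiable_def)
  qed
  then show ?thesis using \<epsilon> deriv by (intro exI[of _ \<epsilon>] conjI exI[of _ x']) (auto simp: x'_def)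
qed

text \<open>Induction on the bound for the number of branches. Off the set \<open>V\<close> of
  non-flat points any choice of values is differentiable, so the components of \<open>V\<close> can
  be treated independently.\<close>

theorem differentiable_selection:
  assumes "open U" "\<And>t. t \<in> U \<Longrightarrow> \<exists>Z. card Z \<le> n \<and> branches_at Z L t"
  shows "\<exists>x::real \<Rightarrow> real. \<forall>t\<in>U. x t \<in> L t \<and> x differentiable at t"
  using assms
proof (induction n arbitrary: U L)
  case 0
  have "U = {}"
  proof (rule ccontr)
    assume "U \<noteq> {}"
    then obtain t where "t \<in> U" by blast
    then obtain Z where "card Z \<le> 0" "branches_at Z L t" using 0(2) by blast
    then show False by (auto simp: branches_at_def)
  qed
  then show ?case by simp
next
  case (Suc n)
  note U = \<open>open U\<close>
  define V where "V = {t \<in> U. \<not> flat_at L t}"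
  have VU: "V \<subseteq> U" by (auto simp: V_def)
  have nonempty: "L t \<noteq> {}" if "t \<in> U" for t
  proof -
    obtain Z where "branches_at Z L t" using Suc.prems(2) \<open>t \<in> U\<close> by blast
    then show ?thesis by (auto simp: branches_at_def dest!: eventually_nhds_x_imp_x)
  qed
  have flat_single: "y = y'" if "flat_at L t" "y \<in> L t" "y' \<in> L t" for t y y'
  proof -
    obtain m d where md: "\<forall>e>0. \<forall>\<^sub>F t' in nhds t. \<forall>y\<in>L t'. dev t m d t' y \<le> e * \<bar>t' - t\<bar>"
      using \<open>flat_at L t\<close> by (auto simp: flat_at_def)
    have "\<forall>y\<in>L t. dev t m d t y \<le> 1 * \<bar>t - t\<bar>"
      by (rule eventually_nhds_x_imp_x[OF md[rule_format, of 1]]) simp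
    then have all: "\<forall>y\<in>L t. y = m" by (simp add: dev_def)
    show ?thesis using bspec[OF all that(2)] bspec[OF all that(3)] by simp
  qed
  \<comment> \<open>Near a non-flat point, a branch inside a cone and one outside it give two
    distinct values, whereas a flat point carries only one.\<close>
  have Vopen: "open V"
    unfolding open_subopen[of V]
  proof (intro ballI)
    fix b assume b: "b \<in> V"
    then have bU: "b \<in> U" and nflat: "\<not> flat_at L b" by (auto simp: V_def)
    obtain Z where Z: "branches_at Z L b" using Suc.prems(2) bU by blast
    then have fin: "finite Z" and diff: "\<And>z. z \<in> Z \<Longrightarrow> z differentiable at b" and "Z \<noteq> {}"
      and LZ: "\<forall>\<^sub>F t in nhds b. L t = (\<lambda>z. z t) ` Z"
      by (auto simp: branches_at_def)
    then obtain z where z: "z \<in> Z" by blast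
    obtain d where d: "(z has_real_derivative d) (at b)" using diff[OF z] by (rule real_differentiableE)
    obtain \<delta> where \<delta>: "\<delta> > 0" and sep: "\<forall>z'\<in>Z. (z' b = z b \<and> (\<forall>e>0. \<forall>\<^sub>F t in at b. dev b (z b) d t (z' t) \<le> e * \<bar>t - b\<bar>)) \<or>
       (\<forall>\<^sub>F t in at b. dev b (z b) d t (z' t) > \<delta> * \<bar>t - b\<bar>)"
      using cone_separation[OF fin diff, of "z b" d] by blast
    have "\<exists>z'\<in>Z. \<forall>\<^sub>F t in at b. dev b (z b) d t (z' t) > \<delta> * \<bar>t - b\<bar>"
      using outside_branch[OF Z nflat sep] .
    then obtain z' where z': "z' \<in> Z" "\<forall>\<^sub>F t in at b. dev b (z b) d t (z' t) > \<delta> * \<bar>t - b\<bar>" by blast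
    have "\<forall>\<^sub>F t in at b. dev b (z b) d t (z t) \<le> \<delta> * \<bar>t - b\<bar>"
      using d \<delta> unfolding has_real_derivative_iff_dev by blast
    moreover have "\<forall>\<^sub>F t in at b. L t = (\<lambda>z. z t) ` Z" "\<forall>\<^sub>F t in at b. t \<in> U"
      using LZ U bU by (auto simp: eventually_nhds_conv_at eventually_at_in_open')
    ultimately have "\<forall>\<^sub>F t in at b. t \<in> V"
      using z'(2)
    proof eventually_elim
      case (elim t)
      have "z t \<noteq> z' t" using elim by auto
      then have "\<not> flat_at L t" using flat_single[of t "z t" "z' t"] elim(2) z z'(1) by blast
      then show ?case using elim by (simp add: V_def)
    qed
    then have "\<forall>\<^sub>F t in nhds b. t \<in> V" using b by (simp add: eventually_nhds_conv_at)
    then show "\<exists>T. open T \<and> b \<in> T \<and> T \<subseteq> V" by (auto simp: eventually_nhds)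
  qed
  have local: "\<exists>\<epsilon>>0. \<exists>x. ball b \<epsilon> \<subseteq> V \<and> x b = z b \<and> (x has_real_derivative d) (at b) \<and>
      (\<forall>t\<in>ball b \<epsilon>. x t \<in> L t \<and> x differentiable at t)"
    if b: "b \<in> V" and Z: "branches_at Z L b" and z: "z \<in> Z" "(z has_real_derivative d) (at b)" for b Z z d
  proof -
    have "\<exists>\<epsilon>>0. \<exists>x. x b = z b \<and> (x has_real_derivative d) (at b) \<and>
        (\<forall>t\<in>ball b \<epsilon>. x t \<in> L t \<and> x differentiable at t)"
    proof (rule local_selection[OF _ U _ _ _ Z z])
      show "b \<in> U" "\<not> flat_at L b" using b by (auto simp: V_def)
      show "\<forall>t\<in>U. \<exists>Z. card Z \<le> Suc n \<and> branches_at Z L t" using Suc.prems(2) by blast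
      show "\<exists>x::real\<Rightarrow>real. \<forall>t\<in>U. x t \<in> L t \<and> x differentiable at t"
        if "open U" "\<forall>t\<in>U. \<exists>Z. card Z \<le> n \<and> branches_at Z L t" for U L
        using Suc.IH[OF that(1)] that(2) by blast
    qed
    then obtain \<epsilon> x where \<epsilon>: "\<epsilon> > 0" "x b = z b" "(x has_real_derivative d) (at b)"
        "\<forall>t\<in>ball b \<epsilon>. x t \<in> L t \<and> x differentiable at t" by blast
    obtain \<epsilon>' where \<epsilon>': "\<epsilon>' > 0" "ball b \<epsilon>' \<subseteq> V" using Vopen b by (auto simp: open_contains_ball)
    show ?thesis
      by (rule exI[of _ "min \<epsilon> \<epsilon>'"], intro conjI exI[of _ x]) (use \<epsilon> \<epsilon>' in auto)
  qed
  have comp: "\<exists>x. \<forall>t\<in>connected_component_set V q. x t \<in> L t \<and> x differentiable at t" if q: "q \<in> V" for q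
  proof (rule selection_on_component[OF _ _ q])
    fix b assume b: "b \<in> V"
    then obtain Z where Z: "branches_at Z L b" using Suc.prems(2) VU by blast
    then obtain z where z: "z \<in> Z" "z differentiable at b" by (auto simp: branches_at_def)
    obtain d where d: "(z has_real_derivative d) (at b)" using z(2) by (rule real_differentiableE)
    obtain \<epsilon> x where "\<epsilon> > 0" "ball b \<epsilon> \<subseteq> V" "\<forall>t\<in>ball b \<epsilon>. x t \<in> L t \<and> x differentiable at t"
      using local[OF b Z z(1) d] by blast
    then show "\<exists>J f. open J \<and> connected J \<and> b \<in> J \<and> J \<subseteq> V \<and> (\<forall>t\<in>J. f t \<in> L t \<and> f differentiable at t)"
      by (intro exI[of _ "ball b \<epsilon>"] exI[of _ x]) auto
  next
    fix J f b
    assume J: "open J" "connected J" "J \<subseteq> V" and f: "\<forall>t\<in>J. f t \<in> L t \<and> f differentiable at t"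
      and b: "b \<in> V" "b \<in> closure J" "b \<notin> J"
    obtain Z where Z: "branches_at Z L b" using Suc.prems(2) VU b(1) by blast
    obtain z where z: "z \<in> Z" and lim: "\<And>d e. (z has_real_derivative d) (at b) \<Longrightarrow> e > 0 \<Longrightarrow>
        \<forall>\<^sub>F t in at b within J. dev b (z b) d t (f t) \<le> e * \<bar>t - b\<bar>"
      using selection_limit[OF Z J(2) b(2,3), of f] f differentiable_imp_continuous_within by blast
    have "z differentiable at b" using Z z by (auto simp: branches_at_def)
    then obtain d where d: "(z has_real_derivative d) (at b)" by (rule real_differentiableE)
    obtain \<epsilon>1 x where x: "\<epsilon>1 > 0" "ball b \<epsilon>1 \<subseteq> V" "x b = z b" "(x has_real_derivative d) (at b)"
        "\<forall>t\<in>ball b \<epsilon>1. x t \<in> L t \<and> x differentiable at t"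
      using local[OF b(1) Z z d] by blast
    obtain \<epsilon>0 where \<epsilon>0: "\<epsilon>0 > 0" "\<And>\<epsilon>. 0 < \<epsilon> \<Longrightarrow> \<epsilon> \<le> \<epsilon>0 \<Longrightarrow> open (ball b \<epsilon> - J - {b})"
      using open_side_ball[OF J(2) b(2,3)] by blast
    define \<epsilon> where "\<epsilon> = min \<epsilon>0 \<epsilon>1"
    have \<epsilon>: "\<epsilon> > 0" "ball b \<epsilon> \<subseteq> ball b \<epsilon>1" and K: "open (ball b \<epsilon> - J - {b})"
      using \<epsilon>0 x(1) by (auto simp: \<epsilon>_def)
    \<comment> \<open>\<open>f\<close> is kept on \<open>J\<close>, and a local selection with the
      same value and slope at \<open>b\<close> continues it across \<open>b\<close>. At
      \<open>b\<close> the two one-sided estimates combine to a derivative; beyond \<open>b\<close>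
      only \<open>x\<close> matters.\<close>
    define f' where "f' t = (if t \<in> J then f t else x t)" for t
    have cong: "f' differentiable at t" if T: "open T" "t \<in> T" "\<And>s. s \<in> T \<Longrightarrow> f' s = g s" "g differentiable at t" for T t g
    proof -
      obtain c where "(g has_real_derivative c) (at t)" using T(4) by (rule real_differentiableE)
      moreover have "\<forall>\<^sub>F s in nhds t. f' s = g s" using T by (auto simp: eventually_nhds)
      ultimately have "(f' has_real_derivative c) (at t)" by (subst DERIV_cong_ev[OF refl _ refl])
      then show ?thesis by (auto simp: real_differentiable_def)
    qed
    have "(f' has_real_derivative d) (at b)"
      unfolding has_real_derivative_iff_dev
    proof (intro allI impI)
      fix e :: real assume e: "e > 0"
      have "\<forall>\<^sub>F t in at b. t \<in> J \<longrightarrow> dev b (z b) d t (f t) \<le> e * \<bar>t - b\<bar>"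
        using lim[OF d e] by (auto simp: eventually_at_filter elim!: eventually_mono)
      moreover have "\<forall>\<^sub>F t in at b. dev b (x b) d t (x t) \<le> e * \<bar>t - b\<bar>"
        using x(4) e unfolding has_real_derivative_iff_dev by blast
      ultimately show "\<forall>\<^sub>F t in at b. dev b (f' b) d t (f' t) \<le> e * \<bar>t - b\<bar>"
        by eventually_elim (use b(3) x(3) in \<open>auto simp: f'_def\<close>)
    qed
    then have db: "f' differentiable at b" by (auto simp: real_differentiable_def)
    have good: "f' t \<in> L t \<and> f' differentiable at t" if t: "t \<in> J \<union> ball b \<epsilon>" for t
    proof -
      consider "t \<in> J" | "t = b" | "t \<in> ball b \<epsilon> - J - {b}" using t by blast
      then show ?thesis
      proof cases
        case 1
        then show ?thesis using f cong[OF J(1) 1, of f] by (auto simp: f'_def)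
      next
        case 2
        then show ?thesis using db x(1,5) b(3) by (auto simp: f'_def)
      next
        case 3
        then have "x t \<in> L t" "x differentiable at t" using x(5) \<epsilon>(2) by blast+
        then show ?thesis using cong[OF K 3, of x] 3 by (auto simp: f'_def)
      qed
    qed
    obtain s where "s \<in> J" "dist s b < \<epsilon>" using b(2) \<epsilon>(1) by (auto simp: closure_approachable)
    then have "s \<in> J \<inter> ball b \<epsilon>" by (simp add: dist_commute)
    then have "J \<inter> ball b \<epsilon> \<noteq> {}" by blast
    then have "connected (J \<union> ball b \<epsilon>)" using J(2) by (intro connected_Un) auto
    then show "\<exists>J' f'. open J' \<and> connected J' \<and> J \<subseteq> J' \<and> b \<in> J' \<and> J' \<subseteq> V \<and> (\<forall>t\<in>J. f' t = f t) \<and>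
        (\<forall>t\<in>J'. f' t \<in> L t \<and> f' differentiable at t)"
      using J \<epsilon> x(2) good by (intro exI[of _ "J \<union> ball b \<epsilon>"] exI[of _ f']) (auto simp: f'_def)
  qed
  have "\<exists>X. \<forall>C\<in>components V. \<forall>t\<in>C. X C t \<in> L t \<and> X C differentiable at t"
    by (rule bchoice) (use comp in \<open>auto simp: components_def\<close>)
  then obtain X where X: "\<And>C t. C \<in> components V \<Longrightarrow> t \<in> C \<Longrightarrow> X C t \<in> L t \<and> X C differentiable at t"
    by blast
  define x where "x t = (if t \<in> V then X (connected_component_set V t) t else (SOME y. y \<in> L t))" for t
  have xL: "x t \<in> L t" if "t \<in> U" for t
  proof (cases "t \<in> V")
    case True
    then show ?thesis using X[of "connected_component_set V t" t] by (auto simp: x_def components_def)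
  next
    case False
    then show ?thesis using nonempty[OF that] by (auto simp: x_def some_in_eq)
  qed
  have "x differentiable at t" if t: "t \<in> U" for t
  proof (cases "t \<in> V")
    case True
    define C where "C = connected_component_set V t"
    have C: "C \<in> components V" "t \<in> C" "open C" using True Vopen
      by (auto simp: C_def components_def intro: open_connected_component)
    have "X C s = x s" if "s \<in> C" for s
    proof -
      have "connected_component_set V s = C" "s \<in> V"
        using that connected_component_eq[of s V t] connected_component_subset[of V t] by (auto simp: C_def)
      then show ?thesis by (simp add: x_def)
    qed
    then have "\<forall>\<^sub>F s in nhds t. x s = X C s" using C by (auto simp: eventually_nhds)
    moreover obtain c where "(X C has_real_derivative c) (at t)"
      using X[OF C(1,2)] by (auto simp: real_differentiable_def)
    ultimately have "(x has_real_derivative c) (at t)" by (subst DERIV_cong_ev[OF refl _ refl])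
    then show ?thesis by (auto simp: real_differentiable_def)
  next
    case False
    then have "flat_at L t" using t by (simp add: V_def)
    then obtain m d where md: "\<And>e. e > 0 \<Longrightarrow> \<forall>\<^sub>F s in nhds t. \<forall>y\<in>L s. dev t m d s y \<le> e * \<bar>s - t\<bar>"
      by (auto simp: flat_at_def)
    have "dev t m d t (x t) \<le> 1 * \<bar>t - t\<bar>"
      using eventually_nhds_x_imp_x[OF md[of 1]] xL[OF t] by auto
    then have m: "x t = m" by (simp add: dev_def)
    have "\<forall>\<^sub>F s in nhds t. s \<in> U" using U t by (simp add: eventually_nhds_in_open)
    \<comment> \<open>Flatness bounds all values of \<open>L\<close> near \<open>t\<close> at once,
      so it does not matter how \<open>x\<close> was chosen there, even if components of
      \<open>V\<close> accumulate at \<open>t\<close>.\<close>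
    then have "(x has_real_derivative d) (at t)"
      unfolding has_real_derivative_iff_dev m
    proof (intro allI impI)
      fix e :: real assume "e > 0"
      from md[OF this] \<open>\<forall>\<^sub>F s in nhds t. s \<in> U\<close>
      have "\<forall>\<^sub>F s in nhds t. dev t m d s (x s) \<le> e * \<bar>s - t\<bar>"
        by eventually_elim (use xL in blast)
      then show "\<forall>\<^sub>F s in at t. dev t m d s (x s) \<le> e * \<bar>s - t\<bar>"
        by (simp add: eventually_nhds_conv_at)
    qed
    then show ?thesis by (auto simp: real_differentiable_def)
  qed
  then show ?case using xL by blast
qed

section \<open>Differentiable enumerations\<close>

text \<open>The counterpart of \<open>branches_at\<close> with multiplicities: \<open>V\<close> is a
  multiset, and the same function may occur in it repeatedly.\<close>

definition diff_roots_at :: "(real \<Rightarrow> real multiset) \<Rightarrow> real \<Rightarrow> bool" where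
  "diff_roots_at \<Lambda> b \<longleftrightarrow> (\<exists>V. (\<forall>v\<in>#V. v differentiable at b) \<and>
     (\<forall>\<^sub>F t in nhds b. \<Lambda> t = image_mset (\<lambda>v. v t) V))"

text \<open>Apply the cone dichotomy to the tangent of \<open>x\<close>: if \<open>z\<close> stays
  outside a cone that contains \<open>x\<close>, the two differ off \<open>b\<close>.\<close>

lemma branch_eq_selection:
  assumes x: "(x has_real_derivative d) (at b)" and z: "z differentiable at (b::real)"
  shows "z b = x b \<and> (z has_real_derivative d) (at b) \<or> (\<forall>\<^sub>F t in at b. z t \<noteq> x t)"
proof -
  obtain \<delta> where \<delta>: "\<delta> > 0" "(z b = x b \<and> (\<forall>e>0. \<forall>\<^sub>F t in at b. dev b (x b) d t (z t) \<le> e * \<bar>t - b\<bar>)) \<or>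
     (\<forall>\<^sub>F t in at b. dev b (x b) d t (z t) > \<delta> * \<bar>t - b\<bar>)"
    using cone_separation1[OF z, of "x b" d] by blast
  have "\<forall>\<^sub>F t in at b. dev b (x b) d t (x t) \<le> \<delta> * \<bar>t - b\<bar>"
    using x \<delta>(1) unfolding has_real_derivative_iff_dev by blast
  from \<delta>(2) show ?thesis
  proof
    assume "z b = x b \<and> (\<forall>e>0. \<forall>\<^sub>F t in at b. dev b (x b) d t (z t) \<le> e * \<bar>t - b\<bar>)"
    then show ?thesis by (simp add: has_real_derivative_iff_dev)
  next
    assume "\<forall>\<^sub>F t in at b. dev b (x b) d t (z t) > \<delta> * \<bar>t - b\<bar>"
    then have "\<forall>\<^sub>F t in at b. z t \<noteq> x t"
      using \<open>\<forall>\<^sub>F t in at b. dev b (x b) d t (x t) \<le> \<delta> * \<bar>t - b\<bar>\<close> by eventually_elim auto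
    then show ?thesis ..
  qed
qed

text \<open>Near \<open>b\<close> the selection may jump between branches, but off \<open>b\<close>
  it can only meet branches with its own value and slope at \<open>b\<close>. These can be
  relabelled pointwise so that \<open>x\<close> itself becomes a branch, which is then
  dropped.\<close>

lemma diff_roots_remove:
  assumes \<Lambda>: "diff_roots_at \<Lambda> b" and x: "x differentiable at b" "\<And>t. x t \<in># \<Lambda> t"
  shows "diff_roots_at (\<lambda>t. \<Lambda> t - {#x t#}) b"
proof -
  obtain V where V: "\<forall>v\<in>#V. v differentiable at b" "\<forall>\<^sub>F t in nhds b. \<Lambda> t = image_mset (\<lambda>v. v t) V"
    using \<Lambda> by (auto simp: diff_roots_at_def)
  \<comment> \<open>Positions in a list serve as labels, because equal functions in \<open>V\<close>
    must remain distinguishable.\<close>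
  obtain vs where vs: "V = mset vs" by (metis ex_mset)
  define I where "I = {..<length vs}"
  define z where "z i = vs ! i" for i
  have fin: "finite I" by (simp add: I_def)
  have "V = image_mset z (mset_set I)"
    unfolding vs I_def z_def by (metis atLeast0LessThan map_nth mset_map mset_upt)
  then have \<Lambda>z: "\<forall>\<^sub>F t in nhds b. \<Lambda> t = image_mset (\<lambda>i. z i t) (mset_set I)"
    using V(2) by (simp add: image_mset.compositionality o_def)
  have zd: "z i differentiable at b" if "i \<in> I" for i
    using V(1) that by (auto simp: vs z_def I_def)
  obtain d where d: "(x has_real_derivative d) (at b)" using x(1) by (rule real_differentiableE)
  define good where "good i \<longleftrightarrow> z i b = x b \<and> (z i has_real_derivative d) (at b)" for i
  have "\<forall>\<^sub>F t in at b. \<forall>i\<in>I. z i t = x t \<longrightarrow> good i"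
  proof (intro eventually_ball_finite fin ballI)
    fix i assume i: "i \<in> I"
    show "\<forall>\<^sub>F t in at b. z i t = x t \<longrightarrow> good i"
    proof (cases "good i")
      case False
      then have "\<forall>\<^sub>F t in at b. z i t \<noteq> x t"
        using branch_eq_selection[OF d zd[OF i]] unfolding good_def by blast
      then show ?thesis by (rule eventually_mono) simp
    qed simp
  qed
  moreover have ex: "\<forall>\<^sub>F t in at b. \<exists>i\<in>I. z i t = x t"
  proof -
    have "\<forall>\<^sub>F t in at b. \<Lambda> t = image_mset (\<lambda>i. z i t) (mset_set I)"
      using \<Lambda>z by (simp add: eventually_nhds_conv_at)
    then show ?thesis
    proof eventually_elim
      case (elim t)
      then have "x t \<in> (\<lambda>i. z i t) ` I" using x(2)[of t] fin by simp
      then show ?case by auto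
    qed
  qed
  ultimately have ev: "\<forall>\<^sub>F t in at b. \<exists>i\<in>I. z i t = x t \<and> good i" by eventually_elim blast
  then obtain i0 where i0: "i0 \<in> I" "good i0"
    using eventually_happens'[OF trivial_limit_at[of b]] by blast
  \<comment> \<open>\<open>c t\<close> labels a branch that carries \<open>x\<close> at time
    \<open>t\<close>. At \<open>b\<close> the label is fixed as \<open>i0\<close>, which is correct
    since every good branch passes through \<open>x b\<close>.\<close>
  define c where "c t = (if t = b then i0 else SOME i. i \<in> I \<and> z i t = x t \<and> good i)" for t
  have c_some: "c t \<in> I \<and> z (c t) t = x t \<and> good (c t)" if "t \<noteq> b" "\<exists>i\<in>I. z i t = x t \<and> good i" for t
    using someI_ex[of "\<lambda>i. i \<in> I \<and> z i t = x t \<and> good i"] that by (auto simp: c_def)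
  have "\<forall>\<^sub>F t in at b. t \<noteq> b" by (simp add: eventually_at_filter)
  with ev have "\<forall>\<^sub>F t in at b. c t \<in> I \<and> z (c t) t = x t \<and> good (c t)"
    by eventually_elim (use c_some in blast)
  then have c: "\<forall>\<^sub>F t in nhds b. c t \<in> I \<and> z (c t) t = x t \<and> good (c t)"
    using i0 by (simp add: eventually_nhds_conv_at c_def good_def)
  \<comment> \<open>Exchanging the values of \<open>z i0\<close> and \<open>z (c t)\<close> at each \<open>t\<close> makes \<open>x\<close> the branch with index \<open>i0\<close>;
    differentiability at \<open>b\<close> survives because both have the same value and derivative there.\<close>
  define w where "w i t = (if i = c t then z i0 t else z i t)" for i t
  have "\<forall>\<^sub>F t in nhds b. \<Lambda> t - {#x t#} = image_mset (\<lambda>i. w i t) (mset_set (I - {i0}))"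
    using c \<Lambda>z
  proof eventually_elim
    case (elim t)
    show ?case
    proof (cases "c t = i0")
      case True
      have "image_mset (\<lambda>i. w i t) (mset_set (I - {i0})) = image_mset (\<lambda>i. z i t) (mset_set (I - {i0}))"
        using fin True by (intro image_mset_cong) (auto simp: w_def)
      moreover have "\<Lambda> t = add_mset (x t) (image_mset (\<lambda>i. z i t) (mset_set (I - {i0})))"
        using elim True mset_set.remove[OF fin i0(1)] by simp
      ultimately show ?thesis by simp
    next
      case False
      define J where "J = I - {i0} - {c t}"
      have 1: "mset_set (I - {i0}) = add_mset (c t) (mset_set J)"
        unfolding J_def using elim False fin by (intro mset_set.remove) auto
      have "image_mset (\<lambda>i. w i t) (mset_set J) = image_mset (\<lambda>i. z i t) (mset_set J)"
        using fin by (intro image_mset_cong) (auto simp: w_def J_def)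
      moreover have "\<Lambda> t = add_mset (x t) (add_mset (z i0 t) (image_mset (\<lambda>i. z i t) (mset_set J)))"
        using elim mset_set.remove[OF fin i0(1)] 1 by simp
      ultimately show ?thesis by (simp add: 1 w_def)
    qed
  qed
  moreover have "w i differentiable at b" if i: "i \<in> I" for i
  proof (cases "good i")
    case True
    have "(w i has_real_derivative d) (at b)"
      unfolding has_real_derivative_iff_dev
    proof (intro allI impI)
      fix e :: real assume e: "e > 0"
      have "\<forall>\<^sub>F t in at b. dev b (x b) d t (z j t) \<le> e * \<bar>t - b\<bar>" if "good j" for j
        using that e unfolding good_def has_real_derivative_iff_dev by metis
      from this[OF True] this[OF i0(2)]
      show "\<forall>\<^sub>F t in at b. dev b (w i b) d t (w i t) \<le> e * \<bar>t - b\<bar>"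
        by eventually_elim (use True i0(2) in \<open>auto simp: w_def good_def\<close>)
    qed
    then show ?thesis by (auto simp: real_differentiable_def)
  next
    case False
    have "\<forall>\<^sub>F t in nhds b. w i t = z i t" using c by eventually_elim (use False in \<open>auto simp: w_def\<close>)
    moreover obtain e where "(z i has_real_derivative e) (at b)" using zd[OF i] by (rule real_differentiableE)
    ultimately have "(w i has_real_derivative e) (at b)" by (subst DERIV_cong_ev[OF refl _ refl])
    then show ?thesis by (auto simp: real_differentiable_def)
  qed
  ultimately show ?thesis
    unfolding diff_roots_at_def using fin
    by (intro exI[of _ "image_mset w (mset_set (I - {i0}))"]) (auto simp: image_mset.compositionality o_def)
qed

lemma card_set_mset_le_size: "card (set_mset A) \<le> size A"
  using size_mset_mono[OF mset_set_set_mset_msubset[of A]] by simp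

text \<open>Select one differentiable root function, remove it by \<open>diff_roots_remove\<close>,
  and repeat with the rest.\<close>

theorem differentiable_enumeration:
  assumes "\<And>t. size (\<Lambda> t) = n" "\<And>b. diff_roots_at \<Lambda> b"
  shows "\<exists>x :: nat \<Rightarrow> real \<Rightarrow> real. (\<forall>i\<in>{1..n}. \<forall>t. x i differentiable at t) \<and>
           (\<forall>t. \<Lambda> t = image_mset (\<lambda>i. x i t) (mset_set {1..n}))"
  using assms
proof (induction n arbitrary: \<Lambda>)
  case 0
  then show ?case by auto
next
  case (Suc n)
  have "\<exists>Z. card Z \<le> Suc n \<and> branches_at Z (\<lambda>t. set_mset (\<Lambda> t)) b" for b
  proof -
    obtain V where V: "\<forall>v\<in>#V. v differentiable at b" "\<forall>\<^sub>F t in nhds b. \<Lambda> t = image_mset (\<lambda>v. v t) V"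
      using Suc.prems(2)[of b] by (auto simp: diff_roots_at_def)
    have "size V = Suc n"
      using eventually_nhds_x_imp_x[OF V(2)] Suc.prems(1)[of b] by simp
    moreover from this have "set_mset V \<noteq> {}" by auto
    moreover have "\<forall>\<^sub>F t in nhds b. set_mset (\<Lambda> t) = (\<lambda>v. v t) ` set_mset V"
      using V(2) by eventually_elim simp
    ultimately show ?thesis
      using V(1) card_set_mset_le_size[of V] by (intro exI[of _ "set_mset V"]) (auto simp: branches_at_def)
  qed
  then obtain x where x: "\<And>t. x t \<in># \<Lambda> t" "\<And>t. x differentiable at t"
    using differentiable_selection[OF open_UNIV, of "Suc n" "\<lambda>t. set_mset (\<Lambda> t)"] by blast
  have "size (\<Lambda> t - {#x t#}) = n" for t
    using Suc.prems(1)[of t] x(1)[of t] by (simp add: size_Diff_singleton)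
  from Suc.IH[OF this diff_roots_remove[OF Suc.prems(2) x(2,1)]]
  obtain y where y: "\<forall>i\<in>{1..n}. \<forall>t. y i differentiable at t"
    "\<And>t. \<Lambda> t - {#x t#} = image_mset (\<lambda>i. y i t) (mset_set {1..n})" by blast
  define y' where "y' = y(Suc n := x)"
  have "\<Lambda> t = image_mset (\<lambda>i. y' i t) (mset_set {1..Suc n})" for t
  proof -
    have "\<Lambda> t = add_mset (x t) (image_mset (\<lambda>i. y i t) (mset_set {1..n}))"
      using y(2)[of t] x(1)[of t] by (metis insert_DiffM)
    also have "image_mset (\<lambda>i. y i t) (mset_set {1..n}) = image_mset (\<lambda>i. y' i t) (mset_set {1..n})"
      by (intro image_mset_cong) (auto simp: y'_def)
    finally show ?thesis by (simp add: atLeastAtMostSuc_conv y'_def)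
  qed
  moreover have "\<forall>i\<in>{1..Suc n}. \<forall>t. y' i differentiable at t"
    using y(1) x(2) by (auto simp: y'_def atLeastAtMostSuc_conv)
  ultimately show ?case by blast
qed

section \<open>Taylor expansions at a point\<close>

text \<open>A Taylor expansion with remainder \<open>o((t - b) ^ n)\<close>. The degree of
  \<open>q\<close> is left free, so products need no truncation.\<close>

definition peano :: "nat \<Rightarrow> real \<Rightarrow> (real \<Rightarrow> real) \<Rightarrow> bool" where
  "peano n b f \<longleftrightarrow> (\<exists>q r. isCont r b \<and> r b = 0 \<and> (\<forall>t. f t = poly q (t - b) + r t * (t - b) ^ n))"

lemma peanoE:
  assumes "peano n b f"
  obtains q r where "isCont r b" "r b = 0" "\<And>t. f t = poly q (t - b) + r t * (t - b) ^ n"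
  using assms by (auto simp: peano_def)

lemma peano_const [simp]: "peano n b (\<lambda>t. c)"
  unfolding peano_def by (intro exI[of _ "[:c:]"] exI[of _ "\<lambda>t. 0"]) auto

lemma peano_add:
  assumes "peano n b f" "peano n b g"
  shows "peano n b (\<lambda>t. f t + g t)"
proof -
  obtain q r where 1: "isCont r b" "r b = 0" "\<And>t. f t = poly q (t - b) + r t * (t - b) ^ n"
    using peanoE[OF assms(1)] by blast
  obtain q' r' where 2: "isCont r' b" "r' b = 0" "\<And>t. g t = poly q' (t - b) + r' t * (t - b) ^ n"
    using peanoE[OF assms(2)] by blast
  have "isCont (\<lambda>t. r t + r' t) b" by (intro continuous_intros 1 2)
  moreover have "r b + r' b = 0" using 1 2 by simp
  moreover have "f t + g t = poly (q + q') (t - b) + (r t + r' t) * (t - b) ^ n" for t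
    using 1 2 by (simp add: algebra_simps)
  ultimately show ?thesis unfolding peano_def by blast
qed

lemma peano_mult:
  assumes "peano n b f" "peano n b g"
  shows "peano n b (\<lambda>t. f t * g t)"
proof -
  obtain q r where 1: "isCont r b" "r b = 0" "\<And>t. f t = poly q (t - b) + r t * (t - b) ^ n"
    using peanoE[OF assms(1)] by blast
  obtain q' r' where 2: "isCont r' b" "r' b = 0" "\<And>t. g t = poly q' (t - b) + r' t * (t - b) ^ n"
    using peanoE[OF assms(2)] by blast
  define R where "R t = poly q (t - b) * r' t + r t * poly q' (t - b) + r t * r' t * (t - b) ^ n" for t
  have "isCont R b" unfolding R_def by (intro continuous_intros 1 2)
  moreover have "R b = 0" using 1 2 by (simp add: R_def)
  moreover have "f t * g t = poly (q * q') (t - b) + R t * (t - b) ^ n" for t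
    using 1 2 by (simp add: R_def algebra_simps)
  ultimately show ?thesis unfolding peano_def by blast
qed

lemma peano_sum: "(\<And>i. i \<in> I \<Longrightarrow> peano n b (f i)) \<Longrightarrow> peano n b (\<lambda>t. \<Sum>i\<in>I. f i t)"
  by (induction I rule: infinite_finite_induct) (auto intro: peano_add)

lemma peano_isCont:
  assumes "peano n b f" shows "isCont f b"
proof -
  obtain q r where 1: "isCont r b" "r b = 0" "\<And>t. f t = poly q (t - b) + r t * (t - b) ^ n"
    using peanoE[OF assms(1)] by blast
  have "f = (\<lambda>t. poly q (t - b) + r t * (t - b) ^ n)" using 1(3) by blast
  moreover have "isCont (\<lambda>t. poly q (t - b) + r t * (t - b) ^ n) b" by (intro continuous_intros 1)
  ultimately show ?thesis by simp
qed

text \<open>For positive \<open>k\<close> the bound forces the constant term to vanish; cancel one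
  factor \<open>t - b\<close> and repeat.\<close>

lemma poly_bigo_dvd:
  assumes "\<forall>\<^sub>F t in at b. \<bar>poly q (t - b)\<bar> \<le> C * \<bar>t - b\<bar> ^ k"
  shows "\<exists>p. \<forall>t. poly q (t - b) = (t - b) ^ k * poly p (t - (b::real))"
  using assms
proof (induction k arbitrary: q)
  case 0
  then show ?case by auto
next
  case (Suc k)
  have "((\<lambda>t. C * \<bar>t - b\<bar> ^ Suc k) \<longlongrightarrow> C * \<bar>b - b\<bar> ^ Suc k) (at b)"
    by (intro tendsto_intros)
  moreover have "((\<lambda>t. \<bar>poly q (t - b)\<bar>) \<longlongrightarrow> \<bar>poly q (b - b)\<bar>) (at b)"
    by (intro tendsto_intros tendsto_poly)
  ultimately have "\<bar>poly q (b - b)\<bar> \<le> C * \<bar>b - b\<bar> ^ Suc k"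
    using Suc.prems by (rule tendsto_le[OF trivial_limit_at])
  then have "poly q 0 = 0" by simp
  then obtain p where p: "q = pCons 0 p" by (cases q) auto
  have "\<forall>\<^sub>F t in at b. t \<noteq> b" by (simp add: eventually_at_filter)
  with Suc.prems have "\<forall>\<^sub>F t in at b. \<bar>poly p (t - b)\<bar> \<le> C * \<bar>t - b\<bar> ^ k"
  proof eventually_elim
    case (elim t)
    then have "\<bar>t - b\<bar> * \<bar>poly p (t - b)\<bar> \<le> \<bar>t - b\<bar> * (C * \<bar>t - b\<bar> ^ k)"
      by (simp add: p abs_mult mult_ac)
    then show ?case using elim by simp
  qed
  from Suc.IH[OF this] obtain s where "\<And>t. poly p (t - b) = (t - b) ^ k * poly s (t - b)" by blast
  then show ?case by (auto simp: p mult_ac)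
qed

text \<open>As \<open>k \<le> n\<close>, the remainder is itself of order \<open>k\<close>, so the
  polynomial part obeys such a bound and is divisible by \<open>(t - b) ^ k\<close>. The quotient
  then has one limit for both sides of \<open>b\<close>.\<close>

lemma peano_bigo_limit:
  assumes f: "peano n b f" and k: "k \<le> n" and bound: "\<forall>\<^sub>F t in at b. \<bar>f t\<bar> \<le> C * \<bar>t - b\<bar> ^ k"
  shows "\<exists>c. ((\<lambda>t. f t / (t - b) ^ k) \<longlongrightarrow> c) (at b)"
proof -
  obtain q r where r: "isCont r b" "r b = 0" and fq: "\<And>t. f t = poly q (t - b) + r t * (t - b) ^ n"
    using peanoE[OF f] by blast
  have lim: "((\<lambda>t. r t * (t - b) ^ (n - k)) \<longlongrightarrow> 0) (at b)"
  proof -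
    have "((\<lambda>t. r t * (t - b) ^ (n - k)) \<longlongrightarrow> r b * (b - b) ^ (n - k)) (at b)"
      using r(1) by (intro tendsto_intros) (simp add: isCont_def)
    then show ?thesis using r(2) by simp
  qed
  have rn: "r t * (t - b) ^ n = r t * (t - b) ^ (n - k) * (t - b) ^ k" for t
    using k by (simp add: mult.assoc flip: power_add)
  have "\<forall>\<^sub>F t in at b. dist (r t * (t - b) ^ (n - k)) 0 < 1"
    using tendstoD[OF lim zero_less_one] .
  with bound have "\<forall>\<^sub>F t in at b. \<bar>poly q (t - b)\<bar> \<le> (C + 1) * \<bar>t - b\<bar> ^ k"
  proof eventually_elim
    case (elim t)
    have "\<bar>poly q (t - b)\<bar> \<le> \<bar>f t\<bar> + \<bar>r t * (t - b) ^ n\<bar>" using fq[of t] by linarith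
    also have "\<bar>r t * (t - b) ^ n\<bar> = \<bar>r t * (t - b) ^ (n - k)\<bar> * \<bar>t - b\<bar> ^ k"
      unfolding rn by (simp add: abs_mult power_abs)
    also have "\<dots> \<le> 1 * \<bar>t - b\<bar> ^ k"
      using elim by (intro mult_right_mono) auto
    finally show ?case using elim by (simp add: distrib_right)
  qed
  from poly_bigo_dvd[OF this] obtain p where p: "\<And>t. poly q (t - b) = (t - b) ^ k * poly p (t - b)" by blast
  have "((\<lambda>t. poly p (t - b) + r t * (t - b) ^ (n - k)) \<longlongrightarrow> poly p (b - b) + 0) (at b)"
    by (intro tendsto_intros tendsto_poly lim)
  moreover have "\<forall>\<^sub>F t in at b. poly p (t - b) + r t * (t - b) ^ (n - k) = f t / (t - b) ^ k"
    unfolding eventually_at_filter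
    by (intro always_eventually allI impI) (simp add: fq p rn field_simps)
  ultimately have "((\<lambda>t. f t / (t - b) ^ k) \<longlongrightarrow> poly p (b - b) + 0) (at b)"
    by (rule Lim_transform_eventually)
  then show ?thesis by blast
qed

text \<open>The point \<open>b\<close> is a minimum, so value and derivative vanish there and two
  factors \<open>t - b\<close> split off; \<open>2 \<le> n\<close> lets them split off the remainder
  as well.\<close>

lemma peano_nonneg_bigo:
  assumes f: "peano n b f" and n: "2 \<le> n" and nonneg: "\<And>t. 0 \<le> f t" and f0: "f b = 0"
  shows "\<exists>C>0. \<forall>\<^sub>F t in at b. f t \<le> C * \<bar>t - b\<bar> ^ 2"
proof -
  obtain q r where r: "isCont r b" "r b = 0" and fq: "\<And>t. f t = poly q (t - b) + r t * (t - b) ^ n"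
    using peanoE[OF f] by blast
  have "poly q 0 = 0" using fq[of b] f0 r(2) by simp
  then obtain p where p: "q = pCons 0 p" by (cases q) auto
  have rn: "r t * (t - b) ^ n = (r t * (t - b) ^ (n - 2)) * (t - b) ^ 2" for t
    using n by (metis le_add_diff_inverse2 mult.assoc power_add)
  \<comment> \<open>\<open>g\<close> is the difference quotient of \<open>f\<close> at
    \<open>b\<close>, continuously extended; its value at \<open>b\<close> is the
    derivative.\<close>
  define g where "g t = poly p (t - b) + (r t * (t - b) ^ (n - 2)) * (t - b)" for t
  have fg: "f t = (t - b) * g t" for t
    unfolding fq p rn g_def by (simp add: algebra_simps power2_eq_square)
  have "isCont g b" unfolding g_def by (intro continuous_intros r)
  then have lim: "(g \<longlongrightarrow> g b) (at b)" by (simp add: isCont_def)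
  have "\<forall>\<^sub>F t in at b. (f t - f b) / (t - b) = g t"
    unfolding eventually_at_filter by (intro always_eventually allI impI) (simp add: f0 fg)
  then have "(f has_real_derivative g b) (at b)"
    unfolding has_field_derivative_iff using Lim_transform_eventually[OF lim] by (simp add: eq_commute)
  then have "g b = 0"
    by (rule DERIV_local_min[of _ _ _ 1]) (use nonneg f0 in auto)
  then have "poly p 0 = 0" by (simp add: g_def)
  then obtain s where s: "p = pCons 0 s" by (cases p) auto
  define h where "h t = poly s (t - b) + r t * (t - b) ^ (n - 2)" for t
  have fh: "f t = h t * (t - b) ^ 2" for t
    unfolding fg g_def s h_def by (simp add: algebra_simps power2_eq_square)
  have "isCont h b" unfolding h_def by (intro continuous_intros r)
  then have "(h \<longlongrightarrow> h b) (at b)" by (simp add: isCont_def)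
  then have "\<forall>\<^sub>F t in at b. h t < \<bar>h b\<bar> + 1"
    by (rule order_tendstoD) auto
  then have "\<forall>\<^sub>F t in at b. f t \<le> (\<bar>h b\<bar> + 1) * \<bar>t - b\<bar> ^ 2"
    by eventually_elim (simp add: fh mult_right_mono)
  then show ?thesis by (intro exI[of _ "\<bar>h b\<bar> + 1"]) auto
qed

text \<open>In the Lagrange form of Taylor's formula the intermediate point is squeezed towards
  \<open>b\<close>. Continuity of the \<open>n\<close>-th derivative then turns its value there into
  the value at \<open>b\<close> plus a vanishing error.\<close>

lemma C_k_peano:
  assumes "C_k n f"
  shows "peano n b f"
proof (cases "n = 0")
  case True
  then have "isCont f b" using assms by (simp add: C_k_def continuous_on_eq_continuous_at)
  then have "isCont (\<lambda>t. f t - f b) b" by (intro continuous_intros)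
  then show ?thesis unfolding peano_def True
    by (intro exI[of _ "[:f b:]"] exI[of _ "\<lambda>t. f t - f b"]) auto
next
  case False
  define D where "D j = (deriv ^^ j) f" for j
  have D0: "D 0 = f" by (simp add: D_def)
  have DERIV: "(D j has_real_derivative D (Suc j) x) (at x)" if "j < n" for j x
  proof -
    have "D j differentiable (at x)" using assms that by (simp add: C_k_def D_def)
    then show ?thesis
      by (auto simp: D_def real_differentiable_def dest: DERIV_imp_deriv)
  qed
  have cont: "isCont (D n) b" using assms by (simp add: C_k_def D_def continuous_on_eq_continuous_at)
  have "\<exists>\<xi>. \<bar>\<xi> - b\<bar> \<le> \<bar>t - b\<bar> \<and> f t = (\<Sum>m<n. (D m b / fact m) * (t - b) ^ m) + (D n \<xi> / fact n) * (t - b) ^ n" for t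
  proof (cases "t = b")
    case True
    have "(\<Sum>m<n. (D m b / fact m) * 0 ^ m) = (\<Sum>m<n. if m = 0 then f b else 0)"
      by (intro sum.cong) (auto simp: D0)
    then show ?thesis using True False by (intro exI[of _ b]) simp
  next
    case ne: False
    obtain \<xi> where "if t < b then t < \<xi> \<and> \<xi> < b else b < \<xi> \<and> \<xi> < t"
        and taylor: "f t = (\<Sum>m<n. (D m b / fact m) * (t - b) ^ m) + (D n \<xi> / fact n) * (t - b) ^ n"
      using Taylor[of n D f "min b t" "max b t" b t] False D0 DERIV ne by auto
    then have "\<bar>\<xi> - b\<bar> \<le> \<bar>t - b\<bar>" by (auto split: if_splits)
    with taylor show ?thesis by blast
  qed
  then obtain \<xi> where \<xi>: "\<And>t. \<bar>\<xi> t - b\<bar> \<le> \<bar>t - b\<bar>"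
    "\<And>t. f t = (\<Sum>m<n. (D m b / fact m) * (t - b) ^ m) + (D n (\<xi> t) / fact n) * (t - b) ^ n"
    by metis
  have \<xi>b: "\<xi> b = b" using \<xi>(1)[of b] by simp
  have "((\<lambda>t. \<xi> t - b) \<longlongrightarrow> 0) (at b)"
  proof (rule Lim_null_comparison)
    show "\<forall>\<^sub>F t in at b. norm (\<xi> t - b) \<le> \<bar>t - b\<bar>" using \<xi>(1) by simp
    have "((\<lambda>t. \<bar>t - b\<bar>) \<longlongrightarrow> \<bar>b - b\<bar>) (at b)" by (intro tendsto_intros)
    then show "((\<lambda>t. \<bar>t - b\<bar>) \<longlongrightarrow> 0) (at b)" by simp
  qed
  then have "isCont \<xi> b" by (simp add: isCont_def \<xi>b LIM_zero_iff)
  then have "isCont (\<lambda>t. D n (\<xi> t)) b" using cont isCont_o2[of b \<xi> "D n"] by (simp add: \<xi>b)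
  then have "isCont (\<lambda>t. (D n (\<xi> t) - D n b) / fact n) b" by (intro continuous_intros) auto
  moreover have "f t = poly (\<Sum>m\<le>n. monom (D m b / fact m) m) (t - b) + (D n (\<xi> t) - D n b) / fact n * (t - b) ^ n" for t
    unfolding \<xi>(2)[of t] by (simp add: poly_sum poly_monom lessThan_Suc_atMost[symmetric] algebra_simps diff_divide_distrib)
  ultimately show ?thesis unfolding peano_def using \<xi>b
    by (intro exI[of _ "\<Sum>m\<le>n. monom (D m b / fact m) m"] exI[of _ "\<lambda>t. (D n (\<xi> t) - D n b) / fact n"]) auto
qed

section \<open>Differentiability at a single point\<close>

text \<open>Values and differences are bounded together because the difference estimate for
  \<open>pCons a p\<close> involves the size of \<open>p\<close>.\<close>

lemma poly_lipschitz_on_bounded: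
  fixes p :: "real poly"
  shows "\<exists>H\<ge>0. \<forall>x y. \<bar>x\<bar> \<le> R \<longrightarrow> \<bar>y\<bar> \<le> R \<longrightarrow> \<bar>poly p x\<bar> \<le> H \<and> \<bar>poly p x - poly p y\<bar> \<le> H * \<bar>x - y\<bar>"
proof (induction p)
  case 0
  then show ?case by auto
next
  case (pCons a p)
  then obtain H where H: "H \<ge> 0" "\<And>x y. \<bar>x\<bar> \<le> R \<Longrightarrow> \<bar>y\<bar> \<le> R \<Longrightarrow> \<bar>poly p x\<bar> \<le> H \<and> \<bar>poly p x - poly p y\<bar> \<le> H * \<bar>x - y\<bar>"
    by blast
  define K where "K = \<bar>a\<bar> + \<bar>R\<bar> * H + H"
  have "\<bar>poly (pCons a p) x\<bar> \<le> K \<and> \<bar>poly (pCons a p) x - poly (pCons a p) y\<bar> \<le> K * \<bar>x - y\<bar>"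
    if xy: "\<bar>x\<bar> \<le> R" "\<bar>y\<bar> \<le> R" for x y
  proof
    have "\<bar>a + x * poly p x\<bar> \<le> \<bar>a\<bar> + \<bar>x\<bar> * \<bar>poly p x\<bar>"
      by (metis abs_mult abs_triangle_ineq)
    also have "\<bar>x\<bar> * \<bar>poly p x\<bar> \<le> \<bar>R\<bar> * H"
      using xy H by (intro mult_mono) auto
    finally show "\<bar>poly (pCons a p) x\<bar> \<le> K" using H(1) by (simp add: K_def)
    have "poly (pCons a p) x - poly (pCons a p) y = x * (poly p x - poly p y) + (x - y) * poly p y"
      by (simp add: algebra_simps)
    then have "\<bar>poly (pCons a p) x - poly (pCons a p) y\<bar> \<le> \<bar>x\<bar> * \<bar>poly p x - poly p y\<bar> + \<bar>x - y\<bar> * \<bar>poly p y\<bar>"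
      by (metis abs_mult abs_triangle_ineq)
    also have "\<bar>x\<bar> * \<bar>poly p x - poly p y\<bar> \<le> \<bar>R\<bar> * (H * \<bar>x - y\<bar>)"
      using xy H by (intro mult_mono) auto
    also have "\<bar>x - y\<bar> * \<bar>poly p y\<bar> \<le> \<bar>x - y\<bar> * H"
      using xy H by (intro mult_left_mono) auto
    finally have "\<bar>poly (pCons a p) x - poly (pCons a p) y\<bar> \<le> (\<bar>R\<bar> * H + H) * \<bar>x - y\<bar>"
      by (simp add: algebra_simps)
    also have "\<dots> \<le> K * \<bar>x - y\<bar>" by (intro mult_right_mono) (auto simp: K_def)
    finally show "\<bar>poly (pCons a p) x - poly (pCons a p) y\<bar> \<le> K * \<bar>x - y\<bar>" .
  qed
  moreover have "K \<ge> 0" using H(1) by (simp add: K_def)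
  ultimately show ?case by blast
qed

lemma finite_separated:
  fixes M :: "real set"
  assumes "finite M"
  shows "\<exists>s>0. \<forall>\<mu>\<in>M. \<forall>\<mu>'\<in>M. \<mu> \<noteq> \<mu>' \<longrightarrow> 2 * s \<le> \<bar>\<mu> - \<mu>'\<bar>"
proof -
  \<comment> \<open>The element 1 keeps \<open>D\<close> nonempty when \<open>M\<close> has at most
    one point.\<close>
  define D where "D = insert 1 ((\<lambda>(x, y). \<bar>x - y\<bar>) ` (M \<times> M) - {0})"
  have fin: "finite D" and ne: "D \<noteq> {}" using assms by (auto simp: D_def)
  have "\<And>d. d \<in> D \<Longrightarrow> d > 0" by (auto simp: D_def)
  then have "Min D > 0" using Min_in[OF fin ne] by blast
  moreover have "Min D \<le> \<bar>\<mu> - \<mu>'\<bar>" if "\<mu> \<in> M" "\<mu>' \<in> M" "\<mu> \<noteq> \<mu>'" for \<mu> \<mu>'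
    using that by (intro Min_le[OF fin]) (auto simp: D_def)
  ultimately show ?thesis by (intro exI[of _ "Min D / 2"]) auto
qed

text \<open>A small product has a factor below \<open>s\<close>. By the separation of
  \<open>M\<close>, all other factors are then at least \<open>s\<close> and can be replaced by
  \<open>s\<close>.\<close>

lemma near_root_of_small_prod:
  fixes M :: "real set"
  assumes M: "finite M" and s: "s > 0" "\<And>\<mu> \<mu>'. \<mu> \<in> M \<Longrightarrow> \<mu>' \<in> M \<Longrightarrow> \<mu> \<noteq> \<mu>' \<Longrightarrow> 2 * s \<le> \<bar>\<mu> - \<mu>'\<bar>"
    and small: "(\<Prod>\<mu>\<in>M. \<bar>x - \<mu>\<bar>) < s ^ card M"
  shows "\<exists>\<mu>\<in>M. \<bar>x - \<mu>\<bar> < s \<and> \<bar>x - \<mu>\<bar> * s ^ (card M - 1) \<le> (\<Prod>\<mu>\<in>M. \<bar>x - \<mu>\<bar>)"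
proof -
  have "\<exists>\<mu>\<in>M. \<bar>x - \<mu>\<bar> < s"
  proof (rule ccontr)
    assume "\<not> ?thesis"
    then have "(\<Prod>\<mu>\<in>M. s) \<le> (\<Prod>\<mu>\<in>M. \<bar>x - \<mu>\<bar>)" using s(1) by (intro prod_mono) auto
    then show False using small by simp
  qed
  then obtain \<mu> where \<mu>: "\<mu> \<in> M" "\<bar>x - \<mu>\<bar> < s" by blast
  have "s \<le> \<bar>x - \<mu>'\<bar>" if "\<mu>' \<in> M - {\<mu>}" for \<mu>'
    using s(2)[of \<mu> \<mu>'] \<mu> that by auto
  then have "(\<Prod>\<mu>\<in>M - {\<mu>}. s) \<le> (\<Prod>\<mu>\<in>M - {\<mu>}. \<bar>x - \<mu>\<bar>)" using s(1) by (intro prod_mono) auto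
  then have "\<bar>x - \<mu>\<bar> * s ^ (card M - 1) \<le> \<bar>x - \<mu>\<bar> * (\<Prod>\<mu>\<in>M - {\<mu>}. \<bar>x - \<mu>\<bar>)"
    using \<mu>(1) M by (intro mult_left_mono) (auto simp: card_Diff_singleton)
  also have "\<dots> = (\<Prod>\<mu>\<in>M. \<bar>x - \<mu>\<bar>)" using prod.remove[OF M \<mu>(1)] by metis
  finally show ?thesis using \<mu> by blast
qed

lemma sum_poly_psum: "(\<Sum>x\<in>#A. poly p x) = (\<Sum>k\<le>degree p. coeff p k * psum k A)"
proof (induction A)
  case (add x A)
  then show ?case by (simp add: poly_altdef sum.distrib distrib_left)
qed simp

lemma peano_sum_poly:
  assumes "\<And>k. peano n b (\<lambda>t. psum k (\<Lambda> t))"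
  shows "peano n b (\<lambda>t. \<Sum>x\<in>#\<Lambda> t. poly p x)"
  unfolding sum_poly_psum by (intro peano_sum peano_mult peano_const assms)

lemma sum_mset_nonneg:
  fixes f :: "real \<Rightarrow> real"
  shows "(\<And>x. x \<in># A \<Longrightarrow> 0 \<le> f x) \<Longrightarrow> 0 \<le> (\<Sum>x\<in>#A. f x)"
  by (induction A) auto

lemma sum_mset_nonneg_ge:
  fixes f :: "real \<Rightarrow> real"
  assumes "x \<in># A" "\<And>y. 0 \<le> f y"
  shows "f x \<le> (\<Sum>y\<in>#A. f y)"
proof -
  obtain B where "A = add_mset x B" using assms(1) by (metis mset_add)
  moreover have "0 \<le> (\<Sum>y\<in>#B. f y)" by (rule sum_mset_nonneg) (use assms(2) in auto)
  ultimately show ?thesis by simp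
qed

lemma roots_within_bigo:
  assumes n: "2 \<le> n" and \<Lambda>: "\<And>k. peano n b (\<lambda>t. psum k (\<Lambda> t))"
    and M: "M = set_mset (\<Lambda> b)" and s: "s > 0" "\<And>\<mu> \<mu>'. \<mu> \<in> M \<Longrightarrow> \<mu>' \<in> M \<Longrightarrow> \<mu> \<noteq> \<mu>' \<Longrightarrow> 2 * s \<le> \<bar>\<mu> - \<mu>'\<bar>"
  shows "\<exists>K\<ge>0. \<forall>\<^sub>F t in at b. \<forall>x\<in>#\<Lambda> t. \<exists>\<mu>\<in>M. \<bar>x - \<mu>\<bar> < s \<and> \<bar>x - \<mu>\<bar> \<le> K * \<bar>t - b\<bar>"
proof -
  have fin: "finite M" by (simp add: M)
  \<comment> \<open>The square makes \<open>p\<close> nonnegative, and \<open>p\<close> vanishes at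
    every root at time \<open>b\<close>; thus the sum of \<open>p\<close> over the roots has a
    minimum at \<open>b\<close> and dominates each single summand.\<close>
  define p where "p = (\<Prod>\<mu>\<in>M. [:- \<mu>, 1:]) ^ 2"
  have p: "poly p x = (\<Prod>\<mu>\<in>M. \<bar>x - \<mu>\<bar>) ^ 2" for x
    by (simp add: p_def poly_prod power2_abs flip: abs_prod)
  define \<psi> where "\<psi> t = (\<Sum>x\<in>#\<Lambda> t. poly p x)" for t
  have "\<psi> b = (\<Sum>x\<in>#\<Lambda> b. 0)"
    unfolding \<psi>_def by (intro arg_cong[of _ _ sum_mset] image_mset_cong) (auto simp: p M prod_zero_iff)
  then have "\<psi> b = 0" by simp
  moreover have nonneg: "0 \<le> poly p x" for x by (simp add: p)
  then have "0 \<le> \<psi> t" for t unfolding \<psi>_def by (intro sum_mset_nonneg) auto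
  moreover have "peano n b \<psi>" unfolding \<psi>_def by (rule peano_sum_poly[OF \<Lambda>])
  ultimately obtain C where C: "C > 0" "\<forall>\<^sub>F t in at b. \<psi> t \<le> C * \<bar>t - b\<bar> ^ 2"
    using peano_nonneg_bigo[OF _ n, of b \<psi>] by blast
  \<comment> \<open>\<open>S\<close> bounds the product of the distances to the other points of
    \<open>M\<close> from below. Dividing the bound \<open>sqrt C * \<bar>t - b\<bar>\<close> for
    the full product by \<open>S\<close> gives the constant \<open>K\<close>.\<close>
  define S where "S = s ^ (card M - 1)"
  have S: "S > 0" using s(1) by (simp add: S_def)
  have "((\<lambda>t. sqrt C * \<bar>t - b\<bar>) \<longlongrightarrow> sqrt C * \<bar>b - b\<bar>) (at b)" by (intro tendsto_intros)
  then have "\<forall>\<^sub>F t in at b. sqrt C * \<bar>t - b\<bar> < s ^ card M"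
    by (rule order_tendstoD) (use s(1) in simp)
  with C(2) have "\<forall>\<^sub>F t in at b. \<forall>x\<in>#\<Lambda> t. \<exists>\<mu>\<in>M. \<bar>x - \<mu>\<bar> < s \<and> \<bar>x - \<mu>\<bar> \<le> sqrt C / S * \<bar>t - b\<bar>"
  proof eventually_elim
    case (elim t)
    show ?case
    proof
      fix x assume x: "x \<in># \<Lambda> t"
      have "(\<Prod>\<mu>\<in>M. \<bar>x - \<mu>\<bar>) ^ 2 \<le> (sqrt C * \<bar>t - b\<bar>) ^ 2"
        using sum_mset_nonneg_ge[OF x, of "poly p"] nonneg elim(1) C(1) by (simp add: p \<psi>_def power_mult_distrib)
      then have le: "(\<Prod>\<mu>\<in>M. \<bar>x - \<mu>\<bar>) \<le> sqrt C * \<bar>t - b\<bar>"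
        by (rule power2_le_imp_le) (use C(1) in simp)
      then obtain \<mu> where "\<mu> \<in> M" "\<bar>x - \<mu>\<bar> < s" "\<bar>x - \<mu>\<bar> * S \<le> (\<Prod>\<mu>\<in>M. \<bar>x - \<mu>\<bar>)"
        using near_root_of_small_prod[OF fin s, of x] elim(2) unfolding S_def by force
      then show "\<exists>\<mu>\<in>M. \<bar>x - \<mu>\<bar> < s \<and> \<bar>x - \<mu>\<bar> \<le> sqrt C / S * \<bar>t - b\<bar>"
        using le S by (intro bexI[of _ \<mu>]) (auto simp: field_simps)
    qed
  qed
  then show ?thesis using C(1) S by (intro exI[of _ "sqrt C / S"]) auto
qed

section \<open>Power sums of difference quotients\<close>

lemma sum_mset_diff_le:
  fixes f g :: "real \<Rightarrow> real" and c :: real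
  assumes "\<And>x. x \<in># A \<Longrightarrow> \<bar>f x - g x\<bar> \<le> c"
  shows "\<bar>(\<Sum>x\<in>#A. f x) - (\<Sum>x\<in>#A. g x)\<bar> \<le> size A * c"
  using assms
proof (induction A)
  case (add x A)
  have "\<bar>f x - g x\<bar> \<le> c" "\<bar>(\<Sum>x\<in>#A. f x) - (\<Sum>x\<in>#A. g x)\<bar> \<le> size A * c"
    using add by auto
  then show ?case by (simp add: algebra_simps)
qed simp

lemma sum_mset_filter:
  fixes f :: "real \<Rightarrow> real"
  shows "(\<Sum>x\<in>#filter_mset P A. f x) = (\<Sum>x\<in>#A. if P x then f x else 0)"
  by (induction A) auto

text \<open>The difference quotients at \<open>b\<close> of the roots near \<mu>. At
  \<open>t = b\<close> division by zero yields only zeros, so the multiset is meaningful on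
  punctured neighbourhoods.\<close>

definition scaled_near :: "(real \<Rightarrow> real multiset) \<Rightarrow> real \<Rightarrow> real \<Rightarrow> real \<Rightarrow> real \<Rightarrow> real multiset" where
  "scaled_near \<Lambda> b s \<mu> t = image_mset (\<lambda>x. (x - \<mu>) / (t - b)) (filter_mset (\<lambda>x. \<bar>x - \<mu>\<bar> < s) (\<Lambda> t))"

lemma psum_scaled_near:
  "t \<noteq> b \<Longrightarrow> (t - b) ^ k * psum k (scaled_near \<Lambda> b s \<mu> t) = (\<Sum>x\<in>#\<Lambda> t. if \<bar>x - \<mu>\<bar> < s then (x - \<mu>) ^ k else 0)"
  unfolding psum_def scaled_near_def
  by (simp add: sum_mset_filter[symmetric] sum_mset_distrib_left image_mset.compositionality o_def power_divide)

text \<open>The polynomial \<open>(x - \<mu>) ^ k * w ^ Suc k\<close> imitates the cut-off power.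
  Near \<mu> the error is \<open>(x - \<mu>) ^ k\<close> times \<open>w ^ Suc k - 1\<close>; near
  the other points \<open>w\<close> is of order \<open>t - b\<close>. The exponent
  \<open>Suc k\<close> makes both errors of order \<open>k + 1\<close>, so one factor survives
  division by \<open>(t - b) ^ k\<close>.\<close>

lemma psum_scaled_near_approx:
  assumes size: "\<And>t. size (\<Lambda> t) = n" and M: "finite M" "\<mu> \<in> M"
    and s: "s > 0" "\<And>\<mu> \<mu>'. \<mu> \<in> M \<Longrightarrow> \<mu>' \<in> M \<Longrightarrow> \<mu> \<noteq> \<mu>' \<Longrightarrow> 2 * s \<le> \<bar>\<mu> - \<mu>'\<bar>"
    and K: "K \<ge> 0" and near: "\<forall>\<^sub>F t in at b. \<forall>x\<in>#\<Lambda> t. \<exists>\<mu>\<in>M. \<bar>x - \<mu>\<bar> < s \<and> \<bar>x - \<mu>\<bar> \<le> K * \<bar>t - b\<bar>"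
    and w: "poly w \<mu> = 1" "\<And>\<mu>'. \<mu>' \<in> M \<Longrightarrow> \<mu>' \<noteq> \<mu> \<Longrightarrow> poly w \<mu>' = 0"
  shows "\<exists>C. \<forall>\<^sub>F t in at b.
           \<bar>(\<Sum>x\<in>#\<Lambda> t. (x - \<mu>) ^ k * poly w x ^ Suc k) / (t - b) ^ k - psum k (scaled_near \<Lambda> b s \<mu> t)\<bar> \<le> C * \<bar>t - b\<bar> \<and>
           \<bar>\<Sum>x\<in>#\<Lambda> t. (x - \<mu>) ^ k * poly w x ^ Suc k\<bar> \<le> C * \<bar>t - b\<bar> ^ k"
proof -
  define R where "R = (\<Sum>\<mu>\<in>M. \<bar>\<mu>\<bar>) + s"
  have R: "\<bar>\<nu>\<bar> + s \<le> R" if "\<nu> \<in> M" for \<nu>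
    using member_le_sum[OF that _ M(1), of abs] by (simp add: R_def)
  have R0: "R > 0" using R[OF M(2)] s(1) by auto
  obtain H where H: "H \<ge> 0" "\<And>x y. \<bar>x\<bar> \<le> R \<Longrightarrow> \<bar>y\<bar> \<le> R \<Longrightarrow> \<bar>poly w x - poly w y\<bar> \<le> H * \<bar>x - y\<bar>"
    using poly_lipschitz_on_bounded[of R w] by blast
  obtain G where G: "G \<ge> 0" "\<And>x y. \<bar>x\<bar> \<le> R \<Longrightarrow> \<bar>y\<bar> \<le> R \<Longrightarrow> \<bar>poly (w ^ Suc k) x - poly (w ^ Suc k) y\<bar> \<le> G * \<bar>x - y\<bar>"
    using poly_lipschitz_on_bounded[of R "w ^ Suc k"] by blast
  \<comment> \<open>The first summand serves roots near \<mu>, the second one roots near other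
    points of \<open>M\<close>.\<close>
  define C where "C = K ^ k * (G * K) + (2 * R) ^ k * (H * K) ^ Suc k"
  have C: "C \<ge> 0" using K H(1) G(1) R0 by (simp add: C_def)
  define f where "f x = (x - \<mu>) ^ k * poly w x ^ Suc k" for x
  define g where "g x = (if \<bar>x - \<mu>\<bar> < s then (x - \<mu>) ^ k else 0)" for x
  have fg: "\<bar>f x - g x\<bar> \<le> C * \<bar>t - b\<bar> ^ Suc k \<and> \<bar>g x\<bar> \<le> K ^ k * \<bar>t - b\<bar> ^ k"
    if \<nu>: "\<nu> \<in> M" "\<bar>x - \<nu>\<bar> < s" "\<bar>x - \<nu>\<bar> \<le> K * \<bar>t - b\<bar>" for x t \<nu>
  proof (cases "\<nu> = \<mu>")
    case True
    have x: "\<bar>x - \<mu>\<bar> ^ k \<le> (K * \<bar>t - b\<bar>) ^ k" using \<nu> True by (intro power_mono) auto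
    have "\<bar>x\<bar> \<le> R" "\<bar>\<mu>\<bar> \<le> R" using R[OF \<nu>(1)] \<nu>(2) True s(1) by auto
    then have "\<bar>poly w x ^ Suc k - 1\<bar> \<le> G * \<bar>x - \<mu>\<bar>" using G(2)[of x \<mu>] w(1) by simp
    also have "\<dots> \<le> G * (K * \<bar>t - b\<bar>)" using \<nu> True G(1) by (intro mult_left_mono) auto
    finally have "\<bar>x - \<mu>\<bar> ^ k * \<bar>poly w x ^ Suc k - 1\<bar> \<le> (K * \<bar>t - b\<bar>) ^ k * (G * (K * \<bar>t - b\<bar>))"
      using x K by (intro mult_mono) auto
    moreover have "f x - g x = (x - \<mu>) ^ k * (poly w x ^ Suc k - 1)"
      using \<nu>(2) True by (simp add: f_def g_def algebra_simps)
    ultimately have "\<bar>f x - g x\<bar> \<le> K ^ k * (G * K) * \<bar>t - b\<bar> ^ Suc k"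
      by (simp add: abs_mult power_abs power_mult_distrib mult_ac)
    also have "\<dots> \<le> C * \<bar>t - b\<bar> ^ Suc k"
      using K H(1) R0 by (intro mult_right_mono) (auto simp: C_def)
    finally show ?thesis using x \<nu>(2) True by (simp add: g_def power_abs power_mult_distrib)
  next
    case False
    then have ns: "\<not> \<bar>x - \<mu>\<bar> < s" using s(2)[OF M(2) \<nu>(1)] \<nu>(2) by auto
    have xR: "\<bar>x\<bar> \<le> R" "\<bar>\<nu>\<bar> \<le> R" "\<bar>\<mu>\<bar> \<le> R" using R[OF \<nu>(1)] R[OF M(2)] \<nu>(2) s(1) by auto
    then have "\<bar>poly w x\<bar> \<le> H * \<bar>x - \<nu>\<bar>" using H(2)[of x \<nu>] w(2)[OF \<nu>(1) False] by simp
    also have "\<dots> \<le> H * (K * \<bar>t - b\<bar>)" using \<nu> H(1) by (intro mult_left_mono) auto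
    finally have "\<bar>poly w x\<bar> ^ Suc k \<le> (H * (K * \<bar>t - b\<bar>)) ^ Suc k" by (intro power_mono) auto
    moreover have "\<bar>x - \<mu>\<bar> ^ k \<le> (2 * R) ^ k" using xR by (intro power_mono) auto
    ultimately have "\<bar>x - \<mu>\<bar> ^ k * \<bar>poly w x\<bar> ^ Suc k \<le> (2 * R) ^ k * (H * (K * \<bar>t - b\<bar>)) ^ Suc k"
      using R0 by (intro mult_mono) auto
    then have "\<bar>f x - g x\<bar> \<le> (2 * R) ^ k * (H * K) ^ Suc k * \<bar>t - b\<bar> ^ Suc k"
      using ns by (simp add: f_def g_def abs_mult power_abs power_mult_distrib mult_ac)
    also have "\<dots> \<le> C * \<bar>t - b\<bar> ^ Suc k"
      using K G(1) by (intro mult_right_mono) (auto simp: C_def)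
    finally show ?thesis using ns K by (simp add: g_def)
  qed
  \<comment> \<open>One constant for both claims: \<open>n * C\<close> bounds the difference, and
    adding \<open>K ^ k\<close> for the cut-off power bounds the sum itself once
    \<open>\<bar>t - b\<bar> < 1\<close>.\<close>
  define B where "B = n * (C + K ^ k)"
  have B: "n * C \<le> B" using K by (simp add: B_def mult_left_mono)
  have "((\<lambda>t. \<bar>t - b\<bar>) \<longlongrightarrow> \<bar>b - b\<bar>) (at b)" by (intro tendsto_intros)
  then have "\<forall>\<^sub>F t in at b. \<bar>t - b\<bar> < 1" by (rule order_tendstoD) simp
  moreover have "\<forall>\<^sub>F t in at b. t \<noteq> b" by (simp add: eventually_at_filter)
  ultimately have "\<forall>\<^sub>F t in at b. \<bar>(\<Sum>x\<in>#\<Lambda> t. f x) / (t - b) ^ k - psum k (scaled_near \<Lambda> b s \<mu> t)\<bar> \<le> B * \<bar>t - b\<bar> \<and>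
           \<bar>\<Sum>x\<in>#\<Lambda> t. f x\<bar> \<le> B * \<bar>t - b\<bar> ^ k"
    using near
  proof eventually_elim
    case (elim t)
    have 1: "\<bar>f x - g x\<bar> \<le> C * \<bar>t - b\<bar> ^ Suc k \<and> \<bar>g x\<bar> \<le> K ^ k * \<bar>t - b\<bar> ^ k" if "x \<in># \<Lambda> t" for x
      using fg[of _ x t] elim(3) that by blast
    have gs: "(\<Sum>x\<in>#\<Lambda> t. g x) = (t - b) ^ k * psum k (scaled_near \<Lambda> b s \<mu> t)"
      using psum_scaled_near[OF elim(2)] by (simp add: g_def)
    have "\<bar>(\<Sum>x\<in>#\<Lambda> t. f x) - (\<Sum>x\<in>#\<Lambda> t. g x)\<bar> \<le> n * (C * \<bar>t - b\<bar> ^ Suc k)"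
      using sum_mset_diff_le[of "\<Lambda> t" f g "C * \<bar>t - b\<bar> ^ Suc k"] 1 size by simp
    also have "\<dots> \<le> B * \<bar>t - b\<bar> ^ Suc k"
      using B by (simp add: mult_right_mono mult.assoc[symmetric])
    finally have "\<bar>(\<Sum>x\<in>#\<Lambda> t. f x) - (t - b) ^ k * psum k (scaled_near \<Lambda> b s \<mu> t)\<bar> \<le> \<bar>t - b\<bar> ^ k * (B * \<bar>t - b\<bar>)"
      by (simp add: gs mult_ac)
    moreover have "(\<Sum>x\<in>#\<Lambda> t. f x) - (t - b) ^ k * psum k (scaled_near \<Lambda> b s \<mu> t)
        = (t - b) ^ k * ((\<Sum>x\<in>#\<Lambda> t. f x) / (t - b) ^ k - psum k (scaled_near \<Lambda> b s \<mu> t))"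
      using elim(2) by (simp add: right_diff_distrib)
    ultimately have "\<bar>t - b\<bar> ^ k * \<bar>(\<Sum>x\<in>#\<Lambda> t. f x) / (t - b) ^ k - psum k (scaled_near \<Lambda> b s \<mu> t)\<bar> \<le> \<bar>t - b\<bar> ^ k * (B * \<bar>t - b\<bar>)"
      by (simp add: abs_mult power_abs)
    then have 2: "\<bar>(\<Sum>x\<in>#\<Lambda> t. f x) / (t - b) ^ k - psum k (scaled_near \<Lambda> b s \<mu> t)\<bar> \<le> B * \<bar>t - b\<bar>"
      using elim(2) by simp
    have "\<bar>f x - 0\<bar> \<le> (C + K ^ k) * \<bar>t - b\<bar> ^ k" if "x \<in># \<Lambda> t" for x
    proof -
      have "C * \<bar>t - b\<bar> ^ Suc k \<le> C * \<bar>t - b\<bar> ^ k"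
        using elim(1) C by (intro mult_left_mono power_decreasing) auto
      then have "\<bar>f x\<bar> \<le> C * \<bar>t - b\<bar> ^ k + K ^ k * \<bar>t - b\<bar> ^ k" using 1[OF that] by linarith
      then show ?thesis by (simp add: distrib_right)
    qed
    then have "\<bar>\<Sum>x\<in>#\<Lambda> t. f x\<bar> \<le> n * ((C + K ^ k) * \<bar>t - b\<bar> ^ k)"
      using sum_mset_diff_le[of "\<Lambda> t" f "\<lambda>_. 0" "(C + K ^ k) * \<bar>t - b\<bar> ^ k"] size by simp
    then show ?case using 2 by (simp add: B_def mult.assoc)
  qed
  then show ?thesis unfolding f_def by blast
qed

lemma isolating_poly:
  fixes M :: "real set"
  assumes "finite M"
  shows "\<exists>w. poly w \<mu> = 1 \<and> (\<forall>\<nu>\<in>M. \<nu> \<noteq> \<mu> \<longrightarrow> poly w \<nu> = 0)"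
proof -
  define W where "W = (\<Prod>\<nu>\<in>M - {\<mu>}. [:- \<nu>, 1:])"
  have "poly W \<mu> \<noteq> 0" "\<And>\<nu>. \<nu> \<in> M \<Longrightarrow> \<nu> \<noteq> \<mu> \<Longrightarrow> poly W \<nu> = 0"
    using assms by (auto simp: W_def poly_prod prod_zero_iff)
  then show ?thesis by (intro exI[of _ "smult (1 / poly W \<mu>) W"]) auto
qed

lemma sum_indicator_count: "(\<Sum>x\<in>#A. if x = \<mu> then 1 else 0 :: real) = count A \<mu>"
  by (induction A) auto

text \<open>The sums \<psi> of the imitating polynomials have Taylor expansions and are of order
  \<open>k\<close>, so \<psi> divided by \<open>(t - b) ^ k\<close> converges, and so do the power
  sums of the difference quotients. \<open>tendsto_enumeration\<close> then yields convergent
  branches.\<close>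

lemma scaled_near_branches:
  assumes size: "\<And>t. size (\<Lambda> t) = n" and \<Lambda>: "\<And>k. peano n b (\<lambda>t. psum k (\<Lambda> t))"
    and M: "M = set_mset (\<Lambda> b)" "\<mu> \<in> M"
    and s: "s > 0" "\<And>\<mu> \<mu>'. \<mu> \<in> M \<Longrightarrow> \<mu>' \<in> M \<Longrightarrow> \<mu> \<noteq> \<mu>' \<Longrightarrow> 2 * s \<le> \<bar>\<mu> - \<mu>'\<bar>"
    and K: "K \<ge> 0" and near: "\<forall>\<^sub>F t in at b. \<forall>x\<in>#\<Lambda> t. \<exists>\<mu>\<in>M. \<bar>x - \<mu>\<bar> < s \<and> \<bar>x - \<mu>\<bar> \<le> K * \<bar>t - b\<bar>"
  shows "\<exists>V. size V = count (\<Lambda> b) \<mu> \<and> (\<forall>v\<in>#V. \<exists>c. (v \<longlongrightarrow> c) (at b)) \<and>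
           (\<forall>\<^sub>F t in at b. scaled_near \<Lambda> b s \<mu> t = image_mset (\<lambda>v. v t) V)"
proof -
  have fin: "finite M" by (simp add: M)
  obtain w where w: "poly w \<mu> = 1" "\<And>\<nu>. \<nu> \<in> M \<Longrightarrow> \<nu> \<noteq> \<mu> \<Longrightarrow> poly w \<nu> = 0"
    using isolating_poly[OF fin] by blast
  define \<psi> where "\<psi> k t = (\<Sum>x\<in>#\<Lambda> t. (x - \<mu>) ^ k * poly w x ^ Suc k)" for k t
  have \<psi>_poly: "\<psi> k = (\<lambda>t. \<Sum>x\<in>#\<Lambda> t. poly ([:- \<mu>, 1:] ^ k * w ^ Suc k) x)" for k
    by (simp add: \<psi>_def fun_eq_iff)
  have peano: "peano n b (\<psi> k)" for k unfolding \<psi>_poly by (rule peano_sum_poly[OF \<Lambda>])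
  have approx: "\<exists>C. \<forall>\<^sub>F t in at b. \<bar>\<psi> k t / (t - b) ^ k - psum k (scaled_near \<Lambda> b s \<mu> t)\<bar> \<le> C * \<bar>t - b\<bar> \<and>
     \<bar>\<psi> k t\<bar> \<le> C * \<bar>t - b\<bar> ^ k" for k
    unfolding \<psi>_def by (rule psum_scaled_near_approx[OF size fin M(2) s K near w])
  have diff0: "((\<lambda>t. psum k (scaled_near \<Lambda> b s \<mu> t) - \<psi> k t / (t - b) ^ k) \<longlongrightarrow> 0) (at b)" for k
  proof -
    obtain C where C: "\<forall>\<^sub>F t in at b. \<bar>\<psi> k t / (t - b) ^ k - psum k (scaled_near \<Lambda> b s \<mu> t)\<bar> \<le> C * \<bar>t - b\<bar>"
      using approx[of k] unfolding eventually_conj_iff by blast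
    have "((\<lambda>t. C * \<bar>t - b\<bar>) \<longlongrightarrow> C * \<bar>b - b\<bar>) (at b)" by (intro tendsto_intros)
    then have lim: "((\<lambda>t. C * \<bar>t - b\<bar>) \<longlongrightarrow> 0) (at b)" by simp
    show ?thesis
      by (rule Lim_null_comparison[OF _ lim]) (use C in \<open>simp add: abs_minus_commute\<close>)
  qed
  have conv: "\<exists>c. ((\<lambda>t. psum k (scaled_near \<Lambda> b s \<mu> t)) \<longlongrightarrow> c) (at b)" if "k \<le> n" for k
  proof -
    obtain C where "\<forall>\<^sub>F t in at b. \<bar>\<psi> k t\<bar> \<le> C * \<bar>t - b\<bar> ^ k"
      using approx[of k] unfolding eventually_conj_iff by blast
    from peano_bigo_limit[OF peano \<open>k \<le> n\<close> this]
    obtain c where "((\<lambda>t. \<psi> k t / (t - b) ^ k) \<longlongrightarrow> c) (at b)" by blast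
    from tendsto_add[OF diff0[of k] this] show ?thesis by auto
  qed
  have "(\<psi> 0 \<longlongrightarrow> \<psi> 0 b) (at b)" using peano_isCont[OF peano] by (simp add: isCont_def)
  moreover have "\<psi> 0 b = count (\<Lambda> b) \<mu>"
  proof -
    have "\<psi> 0 b = (\<Sum>x\<in>#\<Lambda> b. if x = \<mu> then 1 else 0)"
      unfolding \<psi>_def by (intro arg_cong[of _ _ sum_mset] image_mset_cong) (use w M in auto)
    then show ?thesis by (simp add: sum_indicator_count)
  qed
  \<comment> \<open>The power sum of index 0 is the number of roots near \<mu>. Integers that
    converge to the multiplicity are eventually equal to it.\<close>
  ultimately have "((\<lambda>t. psum 0 (scaled_near \<Lambda> b s \<mu> t)) \<longlongrightarrow> real (count (\<Lambda> b) \<mu>)) (at b)"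
    using tendsto_add[OF diff0[of 0]] by force
  then have "((\<lambda>t. real (size (scaled_near \<Lambda> b s \<mu> t))) \<longlongrightarrow> real (count (\<Lambda> b) \<mu>)) (at b)"
    by (simp add: psum_def)
  from tendstoD[OF this zero_less_one]
  have "\<forall>\<^sub>F t in at b. size (scaled_near \<Lambda> b s \<mu> t) = count (\<Lambda> b) \<mu>"
    by eventually_elim (simp add: dist_real_def)
  moreover have "count (\<Lambda> b) \<mu> \<le> n" using count_le_size size by metis
  ultimately show ?thesis using conv by (intro tendsto_enumeration) auto
qed

section \<open>Reassembling the clusters of roots\<close>

lemma filter_mset_partition:
  assumes "finite M" "\<And>x. x \<in># A \<Longrightarrow> \<exists>!\<mu>. \<mu> \<in> M \<and> P \<mu> x"
  shows "(\<Sum>\<mu>\<in>M. filter_mset (P \<mu>) A) = A"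
proof (rule multiset_eqI)
  fix x
  show "count (\<Sum>\<mu>\<in>M. filter_mset (P \<mu>) A) x = count A x"
  proof (cases "x \<in># A")
    case True
    then obtain \<mu> where \<mu>: "\<mu> \<in> M" "P \<mu> x" "\<And>\<nu>. \<nu> \<in> M \<Longrightarrow> P \<nu> x \<Longrightarrow> \<nu> = \<mu>" using assms(2) by blast
    have "(\<Sum>\<nu>\<in>M. count (filter_mset (P \<nu>) A) x) = (\<Sum>\<nu>\<in>M. if \<nu> = \<mu> then count A x else 0)"
    proof (intro sum.cong refl)
      fix \<nu> assume "\<nu> \<in> M"
      then have "P \<nu> x \<longleftrightarrow> \<nu> = \<mu>" using \<mu> by blast
      then show "count (filter_mset (P \<nu>) A) x = (if \<nu> = \<mu> then count A x else 0)" by simp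
    qed
    then show ?thesis using assms(1) \<mu>(1) by (simp add: count_sum)
  next
    case False
    then have "count A x = 0" by (simp add: not_in_iff)
    then have "count (filter_mset (P \<mu>) A) x = 0" for \<mu> by simp
    then show ?thesis using \<open>count A x = 0\<close> by (simp add: count_sum del: count_filter_mset)
  qed
qed

lemma image_mset_sum: "image_mset f (\<Sum>i\<in>I. g i) = (\<Sum>i\<in>I. image_mset f (g i))"
  by (induction I rule: infinite_finite_induct) auto

text \<open>Each cluster around a root \<mu> at time \<open>b\<close> has branches whose difference
  quotients converge. As the clusters are disjoint and exhaust the roots near \<open>b\<close>, the
  union of their branches enumerates all roots.\<close>

theorem diff_roots_of_peano:
  assumes n: "2 \<le> n" and size: "\<And>t. size (\<Lambda> t) = n" and \<Lambda>: "\<And>k. peano n b (\<lambda>t. psum k (\<Lambda> t))"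
  shows "diff_roots_at \<Lambda> b"
proof -
  define M where "M = set_mset (\<Lambda> b)"
  have fin: "finite M" by (simp add: M_def)
  obtain s where s: "s > 0" "\<And>\<mu> \<mu>'. \<mu> \<in> M \<Longrightarrow> \<mu>' \<in> M \<Longrightarrow> \<mu> \<noteq> \<mu>' \<Longrightarrow> 2 * s \<le> \<bar>\<mu> - \<mu>'\<bar>"
    using finite_separated[OF fin] by blast
  obtain K where K: "K \<ge> 0"
    and near: "\<forall>\<^sub>F t in at b. \<forall>x\<in>#\<Lambda> t. \<exists>\<mu>\<in>M. \<bar>x - \<mu>\<bar> < s \<and> \<bar>x - \<mu>\<bar> \<le> K * \<bar>t - b\<bar>"
    using roots_within_bigo[OF n \<Lambda> M_def s] by blast
  define A where "A \<mu> t = filter_mset (\<lambda>x. \<bar>x - \<mu>\<bar> < s) (\<Lambda> t)" for \<mu> t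
  have branches: "\<exists>U. (\<forall>u\<in>#U. u differentiable at b) \<and> (\<forall>\<^sub>F t in nhds b. A \<mu> t = image_mset (\<lambda>u. u t) U)"
    if \<mu>: "\<mu> \<in> M" for \<mu>
  proof -
    obtain V where V: "size V = count (\<Lambda> b) \<mu>" "\<forall>v\<in>#V. \<exists>c. (v \<longlongrightarrow> c) (at b)"
       "\<forall>\<^sub>F t in at b. scaled_near \<Lambda> b s \<mu> t = image_mset (\<lambda>v. v t) V"
      using scaled_near_branches[OF size \<Lambda> M_def \<mu> s K near] by blast
    \<comment> \<open>This undoes the scaling. At \<open>b\<close> every branch takes the value
      \<mu>, and the size of \<open>V\<close> makes the multiplicity right there; the limit of
      \<open>v\<close> becomes the derivative.\<close>
    define u where "u v t = \<mu> + (t - b) * v t" for v :: "real \<Rightarrow> real" and t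
    have "\<forall>\<^sub>F t in at b. t \<noteq> b" by (simp add: eventually_at_filter)
    with V(3) have "\<forall>\<^sub>F t in at b. A \<mu> t = image_mset (\<lambda>v. u v t) V"
    proof eventually_elim
      case (elim t)
      have "A \<mu> t = image_mset (\<lambda>y. \<mu> + (t - b) * y) (scaled_near \<Lambda> b s \<mu> t)"
        using elim(2) by (simp add: A_def scaled_near_def image_mset.compositionality o_def)
      then show ?case using elim(1) by (simp add: u_def image_mset.compositionality o_def)
    qed
    moreover have "A \<mu> b = image_mset (\<lambda>v. u v b) V"
    proof -
      have "A \<mu> b = filter_mset (\<lambda>x. x = \<mu>) (\<Lambda> b)"
        unfolding A_def using s \<mu> by (intro filter_mset_cong refl) (force simp: M_def)
      then show ?thesis by (simp add: filter_eq_replicate_mset u_def V(1) image_mset_const_eq)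
    qed
    ultimately have "\<forall>\<^sub>F t in nhds b. A \<mu> t = image_mset (\<lambda>w. w t) (image_mset u V)"
      by (simp add: eventually_nhds_conv_at image_mset.compositionality o_def)
    moreover have "w differentiable at b" if w: "w \<in># image_mset u V" for w
    proof -
      obtain v c where v: "w = u v" "(v \<longlongrightarrow> c) (at b)" using w V(2) by auto
      have "\<forall>\<^sub>F t in at b. v t = (w t - w b) / (t - b)"
        unfolding eventually_at_filter by (intro always_eventually allI impI) (simp add: v(1) u_def)
      from Lim_transform_eventually[OF v(2) this] have "(w has_real_derivative c) (at b)"
        by (simp add: has_field_derivative_iff)
      then show ?thesis by (auto simp: real_differentiable_def)
    qed
    ultimately show ?thesis by blast
  qed
  have "\<exists>U. \<forall>\<mu>\<in>M. (\<forall>u\<in>#U \<mu>. u differentiable at b) \<and> (\<forall>\<^sub>F t in nhds b. A \<mu> t = image_mset (\<lambda>u. u t) (U \<mu>))"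
    by (intro bchoice ballI branches)
  then obtain U where U: "\<And>\<mu> u. \<mu> \<in> M \<Longrightarrow> u \<in># U \<mu> \<Longrightarrow> u differentiable at b"
    "\<And>\<mu>. \<mu> \<in> M \<Longrightarrow> \<forall>\<^sub>F t in nhds b. A \<mu> t = image_mset (\<lambda>u. u t) (U \<mu>)" by blast
  have "\<forall>\<^sub>F t in nhds b. \<forall>\<mu>\<in>M. A \<mu> t = image_mset (\<lambda>u. u t) (U \<mu>)"
    using U(2) by (intro eventually_ball_finite fin) blast
  moreover have "\<forall>\<^sub>F t in nhds b. \<forall>x\<in>#\<Lambda> t. \<exists>\<mu>\<in>M. \<bar>x - \<mu>\<bar> < s"
  proof -
    have "\<forall>\<^sub>F t in at b. \<forall>x\<in>#\<Lambda> t. \<exists>\<mu>\<in>M. \<bar>x - \<mu>\<bar> < s"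
      using near by (rule eventually_mono) blast
    moreover have "\<forall>x\<in>#\<Lambda> b. \<exists>\<mu>\<in>M. \<bar>x - \<mu>\<bar> < s"
      using s(1) by (metis M_def abs_zero diff_self)
    ultimately show ?thesis by (simp add: eventually_nhds_conv_at)
  qed
  ultimately have "\<forall>\<^sub>F t in nhds b. \<Lambda> t = image_mset (\<lambda>u. u t) (\<Sum>\<mu>\<in>M. U \<mu>)"
  proof eventually_elim
    case (elim t)
    have unique: "\<exists>!\<mu>. \<mu> \<in> M \<and> \<bar>x - \<mu>\<bar> < s" if "x \<in># \<Lambda> t" for x
    proof -
      obtain \<mu> where \<mu>: "\<mu> \<in> M" "\<bar>x - \<mu>\<bar> < s" using elim(2) \<open>x \<in># \<Lambda> t\<close> by blast
      show ?thesis
      proof (rule ex1I[of _ \<mu>])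
        fix \<nu> assume "\<nu> \<in> M \<and> \<bar>x - \<nu>\<bar> < s"
        then show "\<nu> = \<mu>" using s(2)[of \<mu> \<nu>] \<mu> by force
      qed (use \<mu> in simp)
    qed
    have "\<Lambda> t = (\<Sum>\<mu>\<in>M. A \<mu> t)"
      unfolding A_def using filter_mset_partition[OF fin, of "\<Lambda> t" "\<lambda>\<mu> x. \<bar>x - \<mu>\<bar> < s"] unique by metis
    then show ?case using elim(1) by (simp add: image_mset_sum)
  qed
  moreover have "\<forall>u\<in>#(\<Sum>\<mu>\<in>M. U \<mu>). u differentiable at b" using U(1) fin by (auto simp: set_mset_sum)
  ultimately show ?thesis unfolding diff_roots_at_def by blast
qed

section \<open>Hyperbolic polynomials\<close>

lemma coeff_hyp_poly:
  assumes "k \<le> n"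
  shows "coeff (hyp_poly n a) (n - k) = (if k = 0 then 1 else (- 1) ^ k * a k)"
proof -
  have "coeff (hyp_poly n a) (n - k) = (if k = 0 then 1 else 0) + (\<Sum>i=1..n. if i = k then (- 1) ^ k * a k else 0)"
    unfolding hyp_poly_def coeff_add coeff_sum using assms
    by (intro arg_cong2[of _ _ _ _ "(+)"] sum.cong) (auto simp: diff_diff_cancel)
  then show ?thesis using assms by auto
qed

lemma degree_hyp_poly: "degree (hyp_poly n a) = n" and lead_coeff_hyp_poly: "coeff (hyp_poly n a) n = 1"
proof -
  show 1: "coeff (hyp_poly n a) n = 1" using coeff_hyp_poly[of 0 n a] by simp
  have "degree (\<Sum>i=1..n. monom ((-1) ^ i * a i) (n - i)) \<le> n"
    by (intro degree_sum_le) (auto intro: order.trans[OF degree_monom_le])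
  then have "degree (hyp_poly n a) \<le> n"
    unfolding hyp_poly_def by (intro degree_add_le degree_monom_le)
  then show "degree (hyp_poly n a) = n" using 1 by (intro antisym le_degree) auto
qed

lemma coeff_roots_poly: "k \<le> size A \<Longrightarrow> coeff (roots_poly A) (size A - k) = fps_nth (elem_fps A) k"
proof -
  assume "k \<le> size A"
  then have "coeff (roots_poly A) (size A - k) = (\<Sum>i\<le>size A. if i = k then fps_nth (elem_fps A) k else 0)"
    unfolding roots_poly_eq coeff_sum by (intro sum.cong) auto
  then show ?thesis using \<open>k \<le> size A\<close> by simp
qed

section \<open>Real factorization from the complex one\<close>

lemma map_poly_of_real_mult:
  "map_poly complex_of_real (p * q) = map_poly complex_of_real p * map_poly complex_of_real q"
  by (intro poly_eqI) (simp add: coeff_map_poly coeff_mult)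

lemma map_poly_roots_poly:
  "map_poly complex_of_real (roots_poly A) = (\<Prod>x\<in>#A. [:- complex_of_real x, 1:])"
proof (induction A)
  case (add x A)
  have "map_poly complex_of_real ([:- x, 1:] * roots_poly A) = map_poly complex_of_real [:- x, 1:] * map_poly complex_of_real (roots_poly A)"
    by (rule map_poly_of_real_mult)
  also have "map_poly complex_of_real [:- x, 1:] = [:- complex_of_real x, 1:]"
    by (simp add: map_poly_pCons)
  finally show ?case by (simp only: add roots_poly_add image_mset_add_mset prod_mset.add_mset)
qed simp

text \<open>Factor over the complex numbers; all roots are real, so their real parts give the same
  factorization, and comparing coefficients brings it back to real polynomials.\<close>

lemma real_rooted_imp_roots_poly:
  fixes p :: "real poly"
  assumes monic: "lead_coeff p = 1"
    and real: "\<And>z. poly (map_poly complex_of_real p) z = 0 \<Longrightarrow> z \<in> \<real>"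
  shows "\<exists>A. size A = degree p \<and> p = roots_poly A"
proof -
  define P where "P = map_poly complex_of_real p"
  have P: "P \<noteq> 0" "degree P = degree p" "lead_coeff P = 1"
    using monic by (auto simp: P_def degree_map_poly coeff_map_poly map_poly_eq_0_iff)
  define A where "A = image_mset Re (proots P)"
  have "image_mset complex_of_real A = image_mset (\<lambda>z. z) (proots P)"
    unfolding A_def image_mset.compositionality
    using P(1) real by (intro image_mset_cong) (auto simp: P_def complex_is_Real_iff complex_eq_iff)
  then have A: "image_mset complex_of_real A = proots P" by simp
  have "P = (\<Prod>z\<in>#proots P. [:- z, 1:])"
    using complex_poly_decompose_multiset[of P] P(3) by simp
  also have "\<dots> = (\<Prod>x\<in>#A. [:- complex_of_real x, 1:])"
    unfolding A[symmetric] by (simp add: image_mset.compositionality o_def)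
  finally have "map_poly complex_of_real p = map_poly complex_of_real (roots_poly A)"
    by (simp add: P_def map_poly_roots_poly)
  then have "complex_of_real (coeff p k) = complex_of_real (coeff (roots_poly A) k)" for k
    by (metis coeff_map_poly of_real_0)
  then have "p = roots_poly A" by (intro poly_eqI) simp
  moreover have "size A = degree p" by (simp add: A_def size_proots_complex P(2))
  ultimately show ?thesis by blast
qed

text \<open>Newton's identity solved for the power sum of highest index; the constant size of the
  multiset settles index 0.\<close>

lemma peano_psum:
  assumes size: "\<And>t. size (\<Lambda> t) = n" and e: "\<And>k. peano m b (\<lambda>t. fps_nth (elem_fps (\<Lambda> t)) k)"
  shows "peano m b (\<lambda>t. psum k (\<Lambda> t))"
proof (induction k rule: less_induct)
  case (less k)
  show ?case
  proof (cases k)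
    case 0
    then show ?thesis by (simp add: psum_def size)
  next
    case (Suc l)
    have eq: "psum (Suc l) A = (- 1) * (real (Suc l) * fps_nth (elem_fps A) (Suc l)
        + (\<Sum>j=1..l. fps_nth (elem_fps A) j * psum (Suc l - j) A))" for A
      using newton_identity[of l A] by (simp add: sum.atLeast_Suc_atMost algebra_simps del: of_nat_Suc)
    have "peano m b (\<lambda>t. psum (Suc l) (\<Lambda> t))"
      unfolding eq by (intro peano_mult peano_add peano_const peano_sum e less) (use Suc in auto)
    then show ?thesis using Suc by simp
  qed
qed

theorem theorem4p3:
  fixes n :: nat and a :: "nat \<Rightarrow> real \<Rightarrow> real"
  assumes smooth: "\<forall>i\<in>{1..n}. C_k n (a i)"
    and hyperbolic: "\<forall>t. \<forall>z::complex.
        poly (map_poly complex_of_real (hyp_poly n (\<lambda>i. a i t))) z = 0 \<longrightarrow> z \<in> \<real>"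
  shows "\<exists>x :: nat \<Rightarrow> real \<Rightarrow> real.
           (\<forall>i\<in>{1..n}. \<forall>t. x i differentiable (at t)) \<and>
           (\<forall>t. hyp_poly n (\<lambda>i. a i t) = (\<Prod>i=1..n. [:- x i t, 1:]))"
proof -
  \<comment> \<open>The minimum argument needs expansions of second order. In degree 1 the
    coefficient \<open>a 1\<close> is itself the root.\<close>
  consider "n = 0" | "n = 1" | "2 \<le> n" by linarith
  then show ?thesis
  proof cases
    case 1
    then show ?thesis by (simp add: hyp_poly_def)
  next
    case 2
    have "hyp_poly n (\<lambda>i. a i t) = (\<Prod>i=1..n. [:- a i t, 1:])" for t
      using 2 by (simp add: hyp_poly_def monom_altdef)
    moreover have "a 1 differentiable (at t)" for t
      using smooth 2 by (auto simp: C_k_def)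
    ultimately show ?thesis using 2 by (intro exI[of _ a]) auto
  next
    case 3
    have "\<exists>A. size A = n \<and> hyp_poly n (\<lambda>i. a i t) = roots_poly A" for t
      using real_rooted_imp_roots_poly[of "hyp_poly n (\<lambda>i. a i t)"] hyperbolic
      by (simp add: degree_hyp_poly lead_coeff_hyp_poly)
    then obtain \<Lambda> where \<Lambda>: "\<And>t. size (\<Lambda> t) = n" "\<And>t. hyp_poly n (\<lambda>i. a i t) = roots_poly (\<Lambda> t)"
      by metis
    \<comment> \<open>The signs in \<open>hyp_poly\<close> are those of \<open>elem_fps\<close>.
      Index 0 gives the leading coefficient 1, not \<open>a 0\<close>.\<close>
    have elem: "fps_nth (elem_fps (\<Lambda> t)) k = (if k = 0 then 1 else if k \<le> n then (- 1) ^ k * a k t else 0)" for k t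
      using coeff_roots_poly[of k "\<Lambda> t"] coeff_hyp_poly[of k n "\<lambda>i. a i t"] \<Lambda> elem_fps_nth_eq_0[of "\<Lambda> t" k]
      by auto
    have "peano n b (\<lambda>t. fps_nth (elem_fps (\<Lambda> t)) k)" for b k
    proof -
      have "peano n b (\<lambda>t. (- 1) ^ k * a k t)" if "k \<noteq> 0" "k \<le> n"
        using smooth that by (intro peano_mult peano_const C_k_peano) auto
      then show ?thesis unfolding elem by (cases "k = 0"; cases "k \<le> n") simp_all
    qed
    from differentiable_enumeration[OF \<Lambda>(1) diff_roots_of_peano[OF 3 \<Lambda>(1) peano_psum[OF \<Lambda>(1) this]]]
    obtain x where x: "\<forall>i\<in>{1..n}. \<forall>t. x i differentiable at t"
      "\<And>t. \<Lambda> t = image_mset (\<lambda>i. x i t) (mset_set {1..n})" by blast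
    have "hyp_poly n (\<lambda>i. a i t) = (\<Prod>i=1..n. [:- x i t, 1:])" for t
      unfolding \<Lambda>(2) x(2)[of t] roots_poly_def
      by (simp add: image_mset.compositionality o_def prod_unfold_prod_mset)
    then show ?thesis using x(1) by blast
  qed
qed

end
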